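(* Let $m,n$ be positive integers and let $\psi$ be the map from faces of $P(m,n)$ to components of $\overline\Gamma_{(m,n)}$ given by $\psi(F)=\bigcup_{M} g(M)$, the union over the sign matrices $M$ that are vertices of $F$. Then $\psi$ is an isomorphism of posets from the faces of $P(m,n)$ ordered by inclusion to the components of $\overline\Gamma_{(m,n)}$ ordered by containment. Moreover, for every face $F$ of $P(m,n)$, $\dim F=\mathcal{R}(\psi(F))$.
   Context: A sign matrix is a matrix with entries in $\{-1,0,1\}$ whose column partial sums from the top lie in $\{0,1\}$ and whose row partial sums from the left are nonnegative; $P(m,n)$ is the convex hull in $\mathbb{R}^{mn}$ of all $m\times n$ sign matrices. The grid graph $\Gamma_{(m,n)}$ has vertex set $\{(i,j):1\le i\le m+1,\ 1\le j\le n+1\}$, drawn as points of a rectangular grid, with a vertical edge from $(i,j)$ to $(i+1,j)$ and a horizontal edge from $(i,j)$ to $(i,j+1)$ for each $1\le i\le m$, $1\le j\le n$; vertices with $i=m+1$ or $j=n+1$ are boundary vertices. For an $m\times n$ sign matrix $M$ with column partial sums $c_{ij}=\sum_{i'\le i}M_{i'j}$ and row partial sums $r_{ij}=\sum_{j'\le j}M_{ij'}$, the $0$-dimensional component $g(M)$ labels the vertical edge $(i,j)$–$(i+1,j)$ by $\{c_{ij}\}$ and the horizontal edge $(i,j)$–$(i,j+1)$ by $0$ if $r_{ij}=0$, $\star$ otherwise. The union of labelings takes the union of the label sets on vertical edges, and on horizontal edges gives $\star$ if either label is $\star$, else $0$. A component is either the empty labeling (empty component) or a union of a nonempty set of $0$-dimensional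 components. Component $\delta$ is contained in $\delta'$ if each vertical label of $\delta$ is a subset of that of $\delta'$ and each horizontal label of $\delta$ is $\le$ that of $\delta'$ with $0\subseteq\star$. In a component, an edge is darkened if it is vertical with label $\{0,1\}$ or horizontal with label $\star$. The number of regions $\mathcal{R}(\delta)$ of a nonempty component $\delta$ is the number of bounded faces of the planar graph formed by its darkened edges, where the darkened edges ending at boundary vertices (on the right and bottom) are regarded as all meeting at a single point in the exterior region; $\mathcal{R}(\text{empty component})=-1$. The empty face has dimension $-1$. *)

theory Defs
  imports "HOL-Analysis.Analysis"
begin

text \<open>
  An \<open>m \<times> n\<close> matrix is an element of \<^typ>\<open>real ^ 'n ^ 'm\<close>, where the index types
  \<open>'m\<close> and \<open>'n\<close> are finite linear orders with \<open>m = CARD('m)\<close> and \<open>n = CARD('n)\<close>.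
  The order is needed for the partial sums; \<open>idx\<close> below is the unique order isomorphism
  onto \<open>{1..m}\<close> (resp. \<open>{1..n}\<close>).
\<close>

definition idx :: "'a :: {finite,linorder} \<Rightarrow> nat" where
  "idx i = card {..i}"

definition col_sum :: "real ^ 'n :: {finite,linorder} ^ 'm :: {finite,linorder} \<Rightarrow> 'm :: {finite,linorder} \<Rightarrow> 'n :: {finite,linorder} \<Rightarrow> real" where
  "col_sum M i j = (\<Sum>i'\<le>i. M $ i' $ j)"

definition row_sum :: "real ^ 'n :: {finite,linorder} ^ 'm :: {finite,linorder} \<Rightarrow> 'm :: {finite,linorder} \<Rightarrow> 'n :: {finite,linorder} \<Rightarrow> real" where
  "row_sum M i j = (\<Sum>j'\<le>j. M $ i $ j')"

definition sign_matrix :: "real ^ 'n :: {finite,linorder} ^ 'm :: {finite,linorder} \<Rightarrow> bool" where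
  "sign_matrix M \<longleftrightarrow>
     (\<forall>i j. M $ i $ j \<in> {-1, 0, 1}) \<and>
     (\<forall>i j. col_sum M i j \<in> {0, 1}) \<and>
     (\<forall>i j. row_sum M i j \<ge> 0)"

definition sign_matrix_polytope :: "(real ^ 'n :: {finite,linorder} ^ 'm :: {finite,linorder}) set" where
  "sign_matrix_polytope = convex hull {M. sign_matrix M}"

text \<open>
  In a labeling of the grid graph, \<open>vlab \<delta> i j\<close> is the label of the vertical edge from
  \<open>(i,j)\<close> to \<open>(i+1,j)\<close> and \<open>hlab \<delta> i j\<close> that of the horizontal edge from \<open>(i,j)\<close> to
  \<open>(i,j+1)\<close>. \<open>NoLabel\<close> occurs only in the empty labeling.
\<close>

datatype hlabel = NoLabel | Zero | Star

datatype ('m, 'n) labeling =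
  Labeling (vlab: "'m \<Rightarrow> 'n \<Rightarrow> real set") (hlab: "'m \<Rightarrow> 'n \<Rightarrow> hlabel")

definition empty_labeling :: "('m, 'n) labeling" where
  "empty_labeling = Labeling (\<lambda>i j. {}) (\<lambda>i j. NoLabel)"

definition zero_dim_component ::
    "real ^ 'n :: {finite,linorder} ^ 'm :: {finite,linorder} \<Rightarrow> ('m :: {finite,linorder}, 'n :: {finite,linorder}) labeling" where
  "zero_dim_component M =
     Labeling (\<lambda>i j. {col_sum M i j}) (\<lambda>i j. if row_sum M i j = 0 then Zero else Star)"

definition labeling_union :: "('m, 'n) labeling set \<Rightarrow> ('m, 'n) labeling" where
  "labeling_union D =
     Labeling (\<lambda>i j. \<Union>\<delta>\<in>D. vlab \<delta> i j)
       (\<lambda>i j. if \<exists>\<delta>\<in>D. hlab \<delta> i j = Star then Star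
              else if \<exists>\<delta>\<in>D. hlab \<delta> i j = Zero then Zero
              else NoLabel)"

lemma labeling_union_empty: "labeling_union {} = empty_labeling"
  by (simp add: labeling_union_def empty_labeling_def)

definition is_component ::
    "('m :: {finite,linorder}, 'n :: {finite,linorder}) labeling \<Rightarrow> bool" where
  "is_component \<delta> \<longleftrightarrow>
     \<delta> = empty_labeling \<or>
     (\<exists>D. D \<noteq> {} \<and> D \<subseteq> zero_dim_component ` {M. sign_matrix M} \<and> \<delta> = labeling_union D)"

definition hlabel_le :: "hlabel \<Rightarrow> hlabel \<Rightarrow> bool" where
  "hlabel_le x y \<longleftrightarrow> x = y \<or> x = NoLabel \<or> (x = Zero \<and> y = Star)"

definition contained_in :: "('m, 'n) labeling \<Rightarrow> ('m, 'n) labeling \<Rightarrow> bool" where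
  "contained_in \<delta> \<delta>' \<longleftrightarrow>
     (\<forall>i j. vlab \<delta> i j \<subseteq> vlab \<delta>' i j \<and> hlabel_le (hlab \<delta> i j) (hlab \<delta>' i j))"

text \<open>
  The planar drawing: vertex \<open>(i,j)\<close> is placed in row \<open>i\<close> (counted downwards) and column \<open>j\<close>.
  Each darkened edge is a unit segment. A darkened edge ending at a boundary vertex
  \<open>(m+1,j)\<close> or \<open>(i,n+1)\<close> is prolonged by a straight segment from that vertex to the common
  exterior point at position \<open>(m+2,n+2)\<close>. These prolongations lie outside the rectangle
  spanned by the grid and meet one another only in the exterior point, so that the drawing
  is a plane drawing of the graph in which the boundary vertices are merged.
\<close>

definition grid_point :: "nat \<Rightarrow> nat \<Rightarrow> real \<times> real" where
  "grid_point i j = (real j, - real i)"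

definition vertical_arc :: "'m :: {finite,linorder} \<Rightarrow> 'n :: {finite,linorder} \<Rightarrow> (real \<times> real) set" where
  "vertical_arc i j =
     closed_segment (grid_point (idx i) (idx j)) (grid_point (idx i + 1) (idx j)) \<union>
     (if idx i = CARD('m)
      then closed_segment (grid_point (idx i + 1) (idx j)) (grid_point (CARD('m) + 2) (CARD('n) + 2))
      else {})"

definition horizontal_arc :: "'m :: {finite,linorder} \<Rightarrow> 'n :: {finite,linorder} \<Rightarrow> (real \<times> real) set" where
  "horizontal_arc i j =
     closed_segment (grid_point (idx i) (idx j)) (grid_point (idx i) (idx j + 1)) \<union>
     (if idx j = CARD('n)
      then closed_segment (grid_point (idx i) (idx j + 1)) (grid_point (CARD('m) + 2) (CARD('n) + 2))
      else {})"

definition darkened_drawing ::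
    "('m :: {finite,linorder}, 'n :: {finite,linorder}) labeling \<Rightarrow> (real \<times> real) set" where
  "darkened_drawing \<delta> =
     \<Union> {vertical_arc i j | i j. vlab \<delta> i j = {0, 1}} \<union>
     \<Union> {horizontal_arc i j | i j. hlab \<delta> i j = Star}"

definition bounded_faces :: "(real \<times> real) set \<Rightarrow> (real \<times> real) set set" where
  "bounded_faces X = {C \<in> components (- X). bounded C}"

definition num_regions ::
    "('m :: {finite,linorder}, 'n :: {finite,linorder}) labeling \<Rightarrow> int" where
  "num_regions \<delta> =
     (if \<delta> = empty_labeling then -1 else int (card (bounded_faces (darkened_drawing \<delta>))))"

definition face_labeling ::
    "(real ^ 'n :: {finite,linorder} ^ 'm :: {finite,linorder}) set \<Rightarrow> ('m :: {finite,linorder}, 'n :: {finite,linorder}) labeling" where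
  "face_labeling F =
     labeling_union (zero_dim_component ` {M. sign_matrix M \<and> M extreme_point_of F})"

end

theory Submission
  imports Defs
begin

text \<open>
  Column and row partial sums of a matrix are the differences of horizontally, respectively
  vertically, adjacent corner sums, and corner sums live on the cells of the grid graph (the cells
  of row or column \<open>0\<close> being parts of the exterior region). The polytope is given by
  \<open>0 \<le> col_sum \<le> 1\<close> and \<open>0 \<le> row_sum\<close>: shifting all cells whose corner sum has a given
  non-integral fractional part shows that the extreme points of the latter are integral. A face is
  thus determined by its tight inequalities, which is the information that its labeling records.

  The dimension of a face is that of the space of matrices whose column and row sums vanish on the
  edges that are not darkened. In terms of corner sums these are the functions on cells that agree
  across every edge that is not darkened and vanish on the exterior cells. Such a function
  extends to a locally constant function on the complement of the drawing, so that the indicators of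
  the bounded faces form a basis. No appeal to Euler's formula or to the Jordan curve theorem is needed.
\<close>

section \<open>Corner sums\<close>

text \<open>Cell (k, l), for k up to m and l up to n, has the vertical edge (k, l) on its left and
  the horizontal edge (k, l) on top; this fixes which corner sums differ by which partial sum. Cells
  with k = m or l = n continue beyond the grid and taper to the common exterior point, so row and
  column totals remain free, and only row and column 0 are pinned to 0. The count of regions is
  topological: components of the complement of a plane set. The obstacle is to show that cells not
  linked through undarkened edges are not joined by some detour either. A locally constant function
  with different values on them replaces an argument about separating curves. For this, corner sums
  must extend from cells to the whole plane, including the narrow wedges between prolonged edges,
  and this is what the projection from the exterior point is for. The opposite facts, that an
  undarkened edge joins its two cells and that every bounded face contains a cell centre, need only
  explicit paths.\<close>

lemma idx_le_iff: "idx i \<le> idx j \<longleftrightarrow> i \<le> j"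
proof
  assume "idx i \<le> idx j"
  show "i \<le> j"
  proof (rule ccontr)
    assume "\<not> i \<le> j"
    then have "{..j} \<subset> {..i}" by auto
    then have "card {..j} < card {..i}" by (intro psubset_card_mono) auto
    with \<open>idx i \<le> idx j\<close> show False by (simp add: idx_def)
  qed
next
  assume "i \<le> j"
  then show "idx i \<le> idx j" unfolding idx_def by (intro card_mono) auto
qed

lemma idx_eq_iff: "idx i = idx j \<longleftrightarrow> i = j"
  by (metis antisym idx_le_iff order_refl)

lemma idx_ge_1: "1 \<le> idx i"
proof -
  have "card {i} \<le> card {..i}" by (intro card_mono) auto
  then show ?thesis by (simp add: idx_def)
qed

lemma idx_le_CARD: "idx (i :: 'a :: {finite,linorder}) \<le> CARD('a)"
  unfolding idx_def by (intro card_mono) auto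

lemma idx_image: "range (idx :: 'a :: {finite,linorder} \<Rightarrow> nat) = {1..CARD('a)}"
proof (rule card_subset_eq)
  show "range (idx :: 'a \<Rightarrow> nat) \<subseteq> {1..CARD('a)}"
    using idx_ge_1 idx_le_CARD by auto
  show "card (range (idx :: 'a \<Rightarrow> nat)) = card {1..CARD('a)}"
    by (simp add: card_image inj_def idx_eq_iff)
qed simp

lemma idx_surj:
  assumes "1 \<le> k" "k \<le> CARD('a)"
  obtains i :: "'a :: {finite,linorder}" where "idx i = k"
proof -
  have "k \<in> range (idx :: 'a \<Rightarrow> nat)" using assms by (simp add: idx_image)
  then show ?thesis using that by auto
qed

text \<open>Moves a sum from an index type to the naturals, where sums of differences
  telescope.\<close>

lemma sum_idx:
  assumes "a \<le> CARD('a :: {finite,linorder})"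
  shows "(\<Sum>i\<in>{i :: 'a. idx i \<le> a}. g (idx i)) = (\<Sum>k<a. g (Suc k))"
proof -
  have "idx ` {i :: 'a. idx i \<le> a} = {1..a}"
  proof (intro equalityI subsetI)
    fix k assume "k \<in> {1..a}"
    then obtain i :: 'a where "idx i = k" using assms by (meson atLeastAtMost_iff idx_surj order_trans)
    with \<open>k \<in> {1..a}\<close> show "k \<in> idx ` {i :: 'a. idx i \<le> a}" by auto
  qed (use idx_ge_1 in auto)
  then have "bij_betw idx {i :: 'a. idx i \<le> a} {1..a}"
    by (simp add: bij_betw_def inj_on_def idx_eq_iff)
  then have "(\<Sum>i\<in>{i :: 'a. idx i \<le> a}. g (idx i)) = (\<Sum>k\<in>{1..a}. g k)"
    by (rule sum.reindex_bij_betw)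
  also have "\<dots> = (\<Sum>k<a. g (Suc k))"
    using sum.atLeast1_atMost_eq by fastforce
  finally show ?thesis .
qed

text \<open>The arguments are naturals, not indices, so that row and column 0 exist. Arguments
  beyond the last row or column repeat the last value.\<close>

definition corner_sum ::
    "real ^ 'n :: {finite,linorder} ^ 'm :: {finite,linorder} \<Rightarrow> nat \<Rightarrow> nat \<Rightarrow> real" where
  "corner_sum M a b = (\<Sum>i\<in>{i. idx i \<le> a}. \<Sum>j\<in>{j. idx j \<le> b}. M $ i $ j)"

lemma idx_le_0: "{i. idx i \<le> 0} = {}"
  using idx_ge_1 by (metis (mono_tags, lifting) Collect_empty_eq not_one_le_zero le_trans)

lemma corner_sum_0 [simp]: "corner_sum M 0 b = 0" "corner_sum M a 0 = 0"
  unfolding corner_sum_def idx_le_0 by simp_all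

lemma corner_sum_min_row:
  "corner_sum (M :: real ^ 'n :: {finite,linorder} ^ 'm :: {finite,linorder}) (min a CARD('m)) b
     = corner_sum M a b"
  using idx_le_CARD[where 'a = 'm] by (simp add: corner_sum_def)

lemma corner_sum_min_col:
  "corner_sum (M :: real ^ 'n :: {finite,linorder} ^ 'm :: {finite,linorder}) a (min b CARD('n))
     = corner_sum M a b"
  using idx_le_CARD[where 'a = 'n] by (simp add: corner_sum_def)

lemma idx_le_idx: "{j. idx j \<le> idx i} = {..i}"
  by (auto simp: idx_le_iff)

lemma idx_le_idx_insert: "{j. idx j \<le> idx i} = insert i {j. idx j \<le> idx i - 1}"
  using idx_ge_1[of i] idx_eq_iff by (auto simp: le_diff_conv2) force

lemma corner_sum_row_step:
  "corner_sum M (idx i) b = corner_sum M (idx i - 1) b + (\<Sum>j\<in>{j. idx j \<le> b}. M $ i $ j)"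
proof -
  have "i \<notin> {j. idx j \<le> idx i - 1}" using idx_ge_1[of i] by auto
  then show ?thesis
    unfolding corner_sum_def idx_le_idx_insert[of i] by (simp add: sum.insert)
qed

lemma corner_sum_col_step:
  "corner_sum M a (idx j) = corner_sum M a (idx j - 1) + (\<Sum>i\<in>{i. idx i \<le> a}. M $ i $ j)"
proof -
  have "j \<notin> {i. idx i \<le> idx j - 1}" using idx_ge_1[of j] by auto
  then show ?thesis
    unfolding corner_sum_def idx_le_idx_insert[of j] by (simp add: sum.insert sum.distrib)
qed

lemma row_sum_corner: "row_sum M i j = corner_sum M (idx i) (idx j) - corner_sum M (idx i - 1) (idx j)"
  by (simp add: corner_sum_row_step row_sum_def idx_le_idx)

lemma col_sum_corner: "col_sum M i j = corner_sum M (idx i) (idx j) - corner_sum M (idx i) (idx j - 1)"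
  by (simp add: corner_sum_col_step col_sum_def idx_le_idx)

lemma linear_corner_sum: "linear (\<lambda>M. corner_sum M a b)"
  by (rule linearI) (simp_all add: corner_sum_def sum.distrib sum_distrib_left)

lemma linear_col_sum: "linear (\<lambda>M. col_sum M i j)"
  by (rule linearI) (simp_all add: col_sum_def sum.distrib sum_distrib_left)

lemma linear_row_sum: "linear (\<lambda>M. row_sum M i j)"
  by (rule linearI) (simp_all add: row_sum_def sum.distrib sum_distrib_left)

lemmas partial_sum_linear =
  linear_add[OF linear_col_sum] linear_diff[OF linear_col_sum] linear_cmul[OF linear_col_sum]
  linear_add[OF linear_row_sum] linear_diff[OF linear_row_sum] linear_cmul[OF linear_row_sum]
  linear_0[OF linear_col_sum] linear_0[OF linear_row_sum]
  linear_sum[OF linear_col_sum] linear_sum[OF linear_row_sum]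

text \<open>Mixed second difference: the inverse of \<open>corner_sum\<close> on functions that
  vanish on row and column 0.\<close>

definition corner_matrix ::
    "(nat \<Rightarrow> nat \<Rightarrow> real) \<Rightarrow> real ^ 'n :: {finite,linorder} ^ 'm :: {finite,linorder}" where
  "corner_matrix h = (\<chi> i j. (h (idx i) (idx j) - h (idx i) (idx j - 1))
                           - (h (idx i - 1) (idx j) - h (idx i - 1) (idx j - 1)))"

lemma corner_sum_corner_matrix:
  fixes h :: "nat \<Rightarrow> nat \<Rightarrow> real"
  defines "N \<equiv> corner_matrix h :: real ^ 'n :: {finite,linorder} ^ 'm :: {finite,linorder}"
  assumes "\<And>b. h 0 b = 0" "\<And>a. h a 0 = 0" "a \<le> CARD('m)" "b \<le> CARD('n)"
  shows "corner_sum N a b = h a b"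
proof -
  define d where "d k l = (h k l - h k (l - 1)) - (h (k - 1) l - h (k - 1) (l - 1))" for k l
  have "corner_sum N a b =
      (\<Sum>i\<in>{i :: 'm. idx i \<le> a}. \<Sum>j\<in>{j :: 'n. idx j \<le> b}. d (idx i) (idx j))"
    by (simp add: N_def corner_sum_def corner_matrix_def d_def)
  also have "\<dots> = (\<Sum>i\<in>{i :: 'm. idx i \<le> a}. \<Sum>l<b. d (idx i) (Suc l))"
    by (simp add: sum_idx[OF assms(5), of "d k" for k])
  also have "\<dots> = (\<Sum>k<a. \<Sum>l<b. d (Suc k) (Suc l))"
    by (rule sum_idx[OF assms(4), of "\<lambda>k. \<Sum>l<b. d k (Suc l)"])
  also have "\<dots> = (\<Sum>k<a. \<Sum>l<b. (h (Suc k) (Suc l) - h k (Suc l)) - (h (Suc k) l - h k l))"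
    by (simp add: d_def algebra_simps)
  also have "\<dots> = (\<Sum>k<a. h (Suc k) b - h k b)"
    by (simp add: sum_lessThan_telescope[of "\<lambda>l. h (Suc k) l - h k l" for k] assms)
  also have "\<dots> = h a b"
    by (simp add: sum_lessThan_telescope[of "\<lambda>k. h k b"] assms)
  finally show ?thesis .
qed

lemma corner_matrix_corner_sum: "corner_matrix (corner_sum M) = M"
proof -
  have "(corner_sum M (idx i) (idx j) - corner_sum M (idx i) (idx j - 1))
      - (corner_sum M (idx i - 1) (idx j) - corner_sum M (idx i - 1) (idx j - 1)) = M $ i $ j" for i j
  proof -
    have "i \<notin> {i'. idx i' \<le> idx i - 1}" using idx_ge_1[of i] by auto
    then have "(\<Sum>i'\<in>{i'. idx i' \<le> idx i}. M $ i' $ j) = M $ i $ j + (\<Sum>i'\<in>{i'. idx i' \<le> idx i - 1}. M $ i' $ j)"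
      unfolding idx_le_idx_insert[of i] by simp
    then show ?thesis by (simp only: corner_sum_col_step)
  qed
  then show ?thesis by (simp add: corner_matrix_def vec_eq_iff)
qed

lemma corner_sum_eqI:
  fixes M N :: "real ^ 'n :: {finite,linorder} ^ 'm :: {finite,linorder}"
  assumes "\<And>a b. a \<le> CARD('m) \<Longrightarrow> b \<le> CARD('n) \<Longrightarrow> corner_sum M a b = corner_sum N a b"
  shows "M = N"
proof -
  have "corner_sum M a b = corner_sum N a b" for a b
    using assms[of "min a CARD('m)" "min b CARD('n)"] by (simp only: corner_sum_min_row corner_sum_min_col)
  then have "corner_sum M = corner_sum N" by blast
  then show ?thesis by (metis corner_matrix_corner_sum)
qed

text \<open>Steps that are not column sums, namely those at row 0, at column 0 or past the last
  column, are 0, which explains the hypothesis on 0. The set S serves as {0}, as the unit interval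
  and as {0, 1} below.\<close>

lemma corner_sum_diff_in:
  fixes M :: "real ^ 'n :: {finite,linorder} ^ 'm :: {finite,linorder}"
  assumes "\<And>i j. col_sum M i j \<in> S" "0 \<in> S"
  shows "corner_sum M a b - corner_sum M a (b - 1) \<in> S"
proof (cases "a = 0 \<or> b = 0 \<or> b > CARD('n)")
  case True
  then have "corner_sum M a b = corner_sum M a (b - 1)"
  proof (elim disjE)
    assume "b > CARD('n)"
    then have "min b CARD('n) = min (b - 1) CARD('n)" by simp
    then show ?thesis by (metis corner_sum_min_col)
  qed simp_all
  then show ?thesis using assms(2) by simp
next
  case False
  obtain i :: 'm where i: "idx i = min a CARD('m)"
    by (rule idx_surj[of "min a CARD('m)"]) (use False in auto)
  obtain j :: 'n where j: "idx j = b" by (rule idx_surj[of b]) (use False in auto)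
  have "corner_sum M a b - corner_sum M a (b - 1) = col_sum M i j"
    by (simp only: col_sum_corner i j corner_sum_min_row)
  then show ?thesis using assms(1) by simp
qed

text \<open>The grouping exhibits an entry as the difference of two horizontal steps, each of which
  \<open>corner_sum_diff_in\<close> controls.\<close>

lemma entry_eq_corner:
  "M $ i $ j = (corner_sum M (idx i) (idx j) - corner_sum M (idx i) (idx j - 1))
      - (corner_sum M (idx i - 1) (idx j) - corner_sum M (idx i - 1) (idx j - 1))"
proof -
  have "M $ i $ j = corner_matrix (corner_sum M) $ i $ j" by (simp add: corner_matrix_corner_sum)
  then show ?thesis by (simp add: corner_matrix_def)
qed

lemma col_sum_eq_0_imp_eq_0:
  fixes M :: "real ^ 'n :: {finite,linorder} ^ 'm :: {finite,linorder}"
  assumes "\<And>i j. col_sum M i j = 0"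
  shows "M = 0"
  using corner_sum_diff_in[of M "{0}"] assms by (simp add: vec_eq_iff entry_eq_corner)

section \<open>The polytope as a flow polytope\<close>

definition flow_polytope :: "(real ^ 'n :: {finite,linorder} ^ 'm :: {finite,linorder}) set" where
  "flow_polytope = {M. \<forall>i j. 0 \<le> col_sum M i j \<and> col_sum M i j \<le> 1 \<and> 0 \<le> row_sum M i j}"

lemma flow_polytope_eq:
  "flow_polytope =
    (\<Inter>i j. {M. 0 \<le> col_sum M i j} \<inter> {M. col_sum M i j \<le> 1} \<inter> {M. 0 \<le> row_sum M i j})"
  by (auto simp: flow_polytope_def)

lemma convex_flow_polytope: "convex flow_polytope"
  by (intro convexI)
     (auto simp: flow_polytope_def partial_sum_linear intro!: convex_bound_le add_nonneg_nonneg)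

lemma finite_vec_in:
  assumes "finite (A :: 'a set)"
  shows "finite {v :: 'a ^ 'n. \<forall>i. v $ i \<in> A}"
proof -
  have "{v :: 'a ^ 'n. \<forall>i. v $ i \<in> A} \<subseteq> vec_lambda ` (UNIV \<rightarrow>\<^sub>E A)"
  proof
    fix v :: "'a ^ 'n" assume "v \<in> {v. \<forall>i. v $ i \<in> A}"
    then have "v = vec_lambda (vec_nth v)" "vec_nth v \<in> UNIV \<rightarrow>\<^sub>E A" by auto
    then show "v \<in> vec_lambda ` (UNIV \<rightarrow>\<^sub>E A)" by (rule image_eqI)
  qed
  then show ?thesis
    by (rule finite_subset) (intro finite_imageI finite_PiE finite assms)
qed

lemma finite_sign_matrices: "finite {M. sign_matrix M}"
proof (rule finite_subset)
  show "{M. sign_matrix M} \<subseteq> {M. \<forall>i. M $ i \<in> {v. \<forall>j. v $ j \<in> {-1, 0, 1}}}"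
    by (auto simp: sign_matrix_def)
qed (intro finite_vec_in, simp)

text \<open>Row sums have no explicit upper bound, but every entry is a difference of two numbers in
  the unit interval, so column sums alone bound the set.\<close>

lemma compact_flow_polytope:
  "compact (flow_polytope :: (real ^ 'n :: {finite,linorder} ^ 'm :: {finite,linorder}) set)"
proof -
  have entry: "\<bar>M $ i $ j\<bar> \<le> 1" if "M \<in> flow_polytope" for M :: "((real, 'n) vec, 'm) vec" and i j
  proof -
    have "col_sum M i j \<in> {0..1}" for i j using that by (simp add: flow_polytope_def)
    then have "corner_sum M a b - corner_sum M a (b - 1) \<in> {0..1}" for a b
      by (rule corner_sum_diff_in) simp
    from this[of "idx i" "idx j"] this[of "idx i - 1" "idx j"] show ?thesis
      by (simp add: entry_eq_corner abs_le_iff)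
  qed
  have "norm M \<le> (\<Sum>i\<in>(UNIV :: 'm set). \<Sum>j\<in>(UNIV :: 'n set). 1)"
    if "M \<in> flow_polytope" for M :: "((real, 'n) vec, 'm) vec"
  proof -
    have "norm M \<le> (\<Sum>i\<in>UNIV. norm (M $ i))"
      by (simp add: norm_vec_def L2_set_le_sum)
    also have "\<dots> \<le> (\<Sum>i\<in>UNIV. \<Sum>j\<in>UNIV. \<bar>M $ i $ j\<bar>)"
      by (intro sum_mono norm_le_l1_cart)
    also have "\<dots> \<le> (\<Sum>i\<in>(UNIV :: 'm set). \<Sum>j\<in>(UNIV :: 'n set). 1)"
      by (intro sum_mono entry that)
    finally show ?thesis .
  qed
  then have "bounded (flow_polytope :: (((real, 'n) vec, 'm) vec) set)"
    unfolding bounded_iff by blast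
  moreover have "closed (flow_polytope :: (((real, 'n) vec, 'm) vec) set)"
    unfolding flow_polytope_eq
    by (intro closed_INT ballI closed_Int closed_Collect_le continuous_on_const
        linear_continuous_on linear_conv_bounded_linear[THEN iffD1] linear_col_sum linear_row_sum)
  ultimately show ?thesis by (simp add: compact_eq_bounded_closed)
qed

text \<open>A direction that changes only slack constraints can be followed a little both ways,
  since there are finitely many constraints.\<close>

lemma flow_polytope_perturb:
  fixes M D :: "real ^ 'n :: {finite,linorder} ^ 'm :: {finite,linorder}"
  assumes "M \<in> flow_polytope"
    and col: "\<And>i j. col_sum D i j \<noteq> 0 \<Longrightarrow> 0 < col_sum M i j \<and> col_sum M i j < 1"
    and row: "\<And>i j. row_sum D i j \<noteq> 0 \<Longrightarrow> 0 < row_sum M i j"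
  obtains e where "e > 0" "M + e *\<^sub>R D \<in> flow_polytope" "M - e *\<^sub>R D \<in> flow_polytope"
proof -
  have M: "0 \<le> col_sum M i j" "col_sum M i j \<le> 1" "0 \<le> row_sum M i j" for i j
    using assms(1) by (simp_all add: flow_polytope_def)
  \<comment> \<open>D and -D are treated together, so that one small e can be chosen for
    both.\<close>
  have ev: "eventually (\<lambda>e. M + e *\<^sub>R D' \<in> flow_polytope) (at_right (0 :: real))"
    if D': "D' = D \<or> D' = - D" for D'
  proof -
    have lower: "eventually (\<lambda>e. 0 \<le> c + e * d) (at_right (0 :: real))"
      if "d = 0 \<or> 0 < c" "0 \<le> c" for c d :: real
    proof (cases "d = 0")
      case False
      have "((\<lambda>e. c + e * d) \<longlongrightarrow> c) (at_right 0)" by (auto intro!: tendsto_eq_intros)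
      then have "eventually (\<lambda>e. 0 < c + e * d) (at_right 0)"
        by (rule order_tendstoD) (use False that in simp)
      then show ?thesis by (rule eventually_mono) simp
    qed (use that in simp)
    have "col_sum D' i j = 0 \<longleftrightarrow> col_sum D i j = 0" "row_sum D' i j = 0 \<longleftrightarrow> row_sum D i j = 0" for i j
      using D' linear_neg[OF linear_col_sum[of i j], of D] linear_neg[OF linear_row_sum[of i j], of D]
      by auto
    then have col': "col_sum D' i j = 0 \<or> 0 < col_sum M i j \<and> col_sum M i j < 1"
      and row': "row_sum D' i j = 0 \<or> 0 < row_sum M i j" for i j
      using col row by blast+
    have "eventually (\<lambda>e. 0 \<le> col_sum M i j + e * col_sum D' i j) (at_right 0)" for i j
      using col'[of i j] M[of i j] by (intro lower) auto
    \<comment> \<open>The upper bound 1 is the lower bound 0 for the complementary slack 1 -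
      \<open>col_sum\<close>.\<close>
    moreover have "eventually (\<lambda>e. col_sum M i j + e * col_sum D' i j \<le> 1) (at_right 0)" for i j
      using col'[of i j] M[of i j] lower[of "- col_sum D' i j" "1 - col_sum M i j"]
      by (auto simp: algebra_simps)
    moreover have "eventually (\<lambda>e. 0 \<le> row_sum M i j + e * row_sum D' i j) (at_right 0)" for i j
      using row'[of i j] M[of i j] by (intro lower) auto
    ultimately show ?thesis
      by (auto simp: flow_polytope_def partial_sum_linear intro!: eventually_all_finite eventually_conj)
  qed
  have "eventually (\<lambda>e. e > 0 \<and> M + e *\<^sub>R D \<in> flow_polytope \<and> M + e *\<^sub>R (- D) \<in> flow_polytope) (at_right (0 :: real))"
    by (intro eventually_conj ev eventually_at_right_less) auto
  then obtain e where "e > 0" "M + e *\<^sub>R D \<in> flow_polytope" "M + e *\<^sub>R (- D) \<in> flow_polytope"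
    using eventually_happens'[OF trivial_limit_at_right_real] by blast
  with that show thesis by simp
qed

lemma in_open_segment_pm:
  fixes x d :: "'a :: real_vector"
  assumes "e > 0" "d \<noteq> 0"
  shows "x \<in> open_segment (x - e *\<^sub>R d) (x + e *\<^sub>R d)"
proof -
  have "x = midpoint (x - e *\<^sub>R d) (x + e *\<^sub>R d)"
    by (simp add: midpoint_def scaleR_2[symmetric])
  moreover have "x - e *\<^sub>R d \<noteq> x + e *\<^sub>R d"
  proof
    assume "x - e *\<^sub>R d = x + e *\<^sub>R d"
    then have "e *\<^sub>R d + e *\<^sub>R d = 0" by (simp add: algebra_simps)
    then have "(2 * e) *\<^sub>R d = 0" by (metis mult_2 scaleR_add_left)
    with assms show False by simp
  qed
  ultimately show ?thesis by (metis midpoint_in_open_segment)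
qed

text \<open>
  The cells whose corner sum has a prescribed non-zero fractional part may be shifted up and down
  simultaneously: this only changes partial sums that are not integers, hence are not tight.
\<close>

lemma extreme_point_flow_polytope_Ints:
  fixes M :: "real ^ 'n :: {finite,linorder} ^ 'm :: {finite,linorder}"
  assumes ext: "M extreme_point_of flow_polytope"
  shows "corner_sum M a b \<in> \<int>"
proof (rule ccontr)
  assume nonint: "corner_sum M a b \<notin> \<int>"
  define t where "t = frac (corner_sum M a b)"
  define h where "h k l = (if frac (corner_sum M k l) = t then 1 else 0 :: real)" for k l
  define D :: "((real, 'n) vec, 'm) vec" where "D = corner_matrix h"
  \<comment> \<open>As t is not 0, the cells of row and column 0 are not shifted, so h is the corner
    sum function of a matrix.\<close>
  have "t \<noteq> 0" using nonint by (simp add: t_def frac_eq_0_iff)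
  then have h0: "h 0 l = 0" "h k 0 = 0" for k l by (auto simp: h_def)
  have D: "corner_sum D k l = h k l" if "k \<le> CARD('m)" "l \<le> CARD('n)" for k l
    unfolding D_def by (rule corner_sum_corner_matrix) (use h0 that in auto)
  have frac_eq: "frac (x :: real) = frac y" if "x - y \<in> \<int>" for x y
    using frac_add_int_right[OF that, of y] by simp
  have h_eq: "h k l = h k' l'" if "corner_sum M k l - corner_sum M k' l' \<in> \<int>" for k l k' l'
    unfolding h_def using frac_eq[OF that] by simp
  have M: "M \<in> flow_polytope" using ext by (simp add: extreme_point_of_def)
  have col: "0 < col_sum M i j \<and> col_sum M i j < 1" if "col_sum D i j \<noteq> 0" for i j
  proof -
    have "h (idx i) (idx j) \<noteq> h (idx i) (idx j - 1)"
      using that idx_le_CARD[of i] idx_le_CARD[of j] by (simp add: col_sum_corner D)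
    then have "col_sum M i j \<notin> \<int>" 
      using h_eq[of "idx i" "idx j" "idx i" "idx j - 1"] unfolding col_sum_corner by blast
    moreover have "0 \<le> col_sum M i j" "col_sum M i j \<le> 1" using M by (simp_all add: flow_polytope_def)
    moreover have "col_sum M i j \<noteq> 0" "col_sum M i j \<noteq> 1" using calculation(1) by auto
    ultimately show ?thesis by linarith
  qed
  have row: "0 < row_sum M i j" if "row_sum D i j \<noteq> 0" for i j
  proof -
    have "h (idx i) (idx j) \<noteq> h (idx i - 1) (idx j)"
      using that idx_le_CARD[of i] idx_le_CARD[of j] by (simp add: row_sum_corner D)
    then have "row_sum M i j \<notin> \<int>" 
      using h_eq[of "idx i" "idx j" "idx i - 1" "idx j"] unfolding row_sum_corner by blast
    moreover have "0 \<le> row_sum M i j" using M by (simp add: flow_polytope_def)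
    moreover have "row_sum M i j \<noteq> 0" using calculation(1) by auto
    ultimately show ?thesis by linarith
  qed
  obtain e where e: "e > 0" "M + e *\<^sub>R D \<in> flow_polytope" "M - e *\<^sub>R D \<in> flow_polytope"
    using flow_polytope_perturb[OF M col row] by blast
  \<comment> \<open>The indices a and b may exceed the size of the matrix; clamping keeps the corner
    sum and reaches a cell that is shifted.\<close>
  have "corner_sum D (min a CARD('m)) (min b CARD('n)) = 1"
    by (simp add: D) (simp add: h_def t_def corner_sum_min_row corner_sum_min_col)
  then have "D \<noteq> 0" by (auto simp: corner_sum_def)
  then have "M \<in> open_segment (M - e *\<^sub>R D) (M + e *\<^sub>R D)" using e(1) by (intro in_open_segment_pm)
  with ext e show False by (auto simp: extreme_point_of_def)
qed

text \<open>An inequality that is tight inside a segment is tight at both ends.\<close>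

lemma convex_comb_nonneg_0:
  fixes x y u :: real
  assumes "0 < u" "u < 1" "0 \<le> x" "0 \<le> y" "(1 - u) * x + u * y = 0"
  shows "x = 0 \<and> y = 0"
proof -
  have "0 \<le> (1 - u) * x" "0 \<le> u * y" using assms by simp_all
  then have "(1 - u) * x = 0" "u * y = 0" using assms(5) by linarith+
  then show ?thesis using assms by simp
qed

text \<open>Integral corner sums make column sums 0 or 1 and entries differences of such numbers.
  Conversely, a sign matrix has only tight column sums, so the ends of a segment through it share
  its column sums, and these determine a matrix.\<close>

lemma extreme_point_iff_sign_matrix: "M extreme_point_of flow_polytope \<longleftrightarrow> sign_matrix M"
proof
  assume ext: "M extreme_point_of flow_polytope"
  then have M: "M \<in> flow_polytope" by (simp add: extreme_point_of_def)
  note int = extreme_point_flow_polytope_Ints[OF ext]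
  have 01: "x \<in> {0, 1}" if "x \<in> \<int>" "0 \<le> x" "x \<le> 1" for x :: real
    using that by (auto elim!: Ints_cases)
  have col: "col_sum M i j \<in> {0, 1}" for i j
  proof (rule 01)
    show "col_sum M i j \<in> \<int>" by (simp add: col_sum_corner int)
  qed (use M in \<open>simp_all add: flow_polytope_def\<close>)
  then have "corner_sum M a b - corner_sum M a (b - 1) \<in> {0, 1}" for a b
    by (rule corner_sum_diff_in) simp
  from this[of "idx _" "idx _"] this[of "idx _ - 1" "idx _"]
  have "M $ i $ j \<in> {-1, 0, 1}" for i j
    unfolding entry_eq_corner[of M i j] by (smt (verit) insert_iff singletonD)
  with col M show "sign_matrix M" by (simp add: sign_matrix_def flow_polytope_def)
next
  assume sign: "sign_matrix M"
  then have 01: "col_sum M i j = 0 \<or> col_sum M i j = 1" for i j by (simp add: sign_matrix_def)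
  have "M \<in> flow_polytope"
    unfolding flow_polytope_def
  proof (intro CollectI allI)
    fix i j
    show "0 \<le> col_sum M i j \<and> col_sum M i j \<le> 1 \<and> 0 \<le> row_sum M i j"
      using 01[of i j] sign by (simp add: sign_matrix_def del: insert_iff) linarith
  qed
  moreover have "M \<notin> open_segment A B" if "A \<in> flow_polytope" "B \<in> flow_polytope" for A B
  proof
    assume "M \<in> open_segment A B"
    then obtain u where "A \<noteq> B" and u: "0 < u" "u < 1" "M = (1 - u) *\<^sub>R A + u *\<^sub>R B"
      by (auto simp: in_segment)
    have "col_sum (A - B) i j = 0" for i j
    proof -
      have eq: "col_sum M i j = (1 - u) * col_sum A i j + u * col_sum B i j"
        by (simp add: u partial_sum_linear)
      have AB: "0 \<le> col_sum A i j" "col_sum A i j \<le> 1" "0 \<le> col_sum B i j" "col_sum B i j \<le> 1"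
        using that by (simp_all add: flow_polytope_def)
      have "col_sum A i j = col_sum B i j"
      proof (cases "col_sum M i j = 0")
        case True
        have "col_sum A i j = 0 \<and> col_sum B i j = 0"
          by (rule convex_comb_nonneg_0[OF u(1,2) AB(1,3)]) (use True eq in simp)
        then show ?thesis by simp
      next
        case False
        then have "(1 - u) * (1 - col_sum A i j) + u * (1 - col_sum B i j) = 0"
          using 01[of i j] eq by (simp add: algebra_simps)
        then have "1 - col_sum A i j = 0 \<and> 1 - col_sum B i j = 0"
          by (intro convex_comb_nonneg_0[OF u(1,2)]) (use AB in simp_all)
        then show ?thesis by simp
      qed
      then show ?thesis by (simp add: partial_sum_linear)
    qed
    then have "A - B = 0" by (rule col_sum_eq_0_imp_eq_0)
    with \<open>A \<noteq> B\<close> show False by simp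
  qed
  ultimately show "M extreme_point_of flow_polytope" by (auto simp: extreme_point_of_def)
qed

lemma sign_matrix_polytope_eq: "sign_matrix_polytope = flow_polytope"
  unfolding sign_matrix_polytope_def
  by (subst Krein_Milman_Minkowski[OF compact_flow_polytope convex_flow_polytope])
     (simp only: extreme_point_iff_sign_matrix)

section \<open>Faces and labelings\<close>

text \<open>\<open>Zero\<close> is covered as the label that is neither \<open>Star\<close> nor
  \<open>NoLabel\<close>; compare \<open>labeling_eqI\<close>.\<close>

lemma zero_dim_component_union:
  "vlab (labeling_union (zero_dim_component ` V)) i j = (\<lambda>M. col_sum M i j) ` V"
  "hlab (labeling_union (zero_dim_component ` V)) i j = Star \<longleftrightarrow> (\<exists>M\<in>V. row_sum M i j \<noteq> 0)"
  "hlab (labeling_union (zero_dim_component ` V)) i j = NoLabel \<longleftrightarrow> V = {}"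
  by (auto simp: labeling_union_def zero_dim_component_def)

lemma labeling_eqI:
  assumes "\<And>i j. vlab \<delta> i j = vlab \<delta>' i j"
    and "\<And>i j. hlab \<delta> i j = Star \<longleftrightarrow> hlab \<delta>' i j = Star"
    and "\<And>i j. hlab \<delta> i j = NoLabel \<longleftrightarrow> hlab \<delta>' i j = NoLabel"
  shows "\<delta> = \<delta>'"
proof -
  have "hlab \<delta> i j = hlab \<delta>' i j" for i j
    using assms(2,3)[of i j] by (cases "hlab \<delta> i j"; cases "hlab \<delta>' i j") auto
  with assms(1) show ?thesis by (intro labeling.expand conjI ext)
qed

text \<open>Letting V be empty absorbs the separate clause for the empty labeling.\<close>

lemma is_component_iff:
  "is_component \<delta> \<longleftrightarrow> (\<exists>V \<subseteq> {M. sign_matrix M}. \<delta> = labeling_union (zero_dim_component ` V))"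
proof
  assume "is_component \<delta>"
  then consider "\<delta> = empty_labeling"
    | D where "D \<subseteq> zero_dim_component ` {M. sign_matrix M}" "\<delta> = labeling_union D"
    unfolding is_component_def by blast
  then show "\<exists>V \<subseteq> {M. sign_matrix M}. \<delta> = labeling_union (zero_dim_component ` V)"
  proof cases
    case 1
    then show ?thesis by (intro exI[of _ "{}"]) (simp add: labeling_union_empty)
  next
    case 2
    then show ?thesis using subset_imageE by metis
  qed
next
  assume "\<exists>V \<subseteq> {M. sign_matrix M}. \<delta> = labeling_union (zero_dim_component ` V)"
  then obtain V where V: "V \<subseteq> {M. sign_matrix M}" "\<delta> = labeling_union (zero_dim_component ` V)"
    by blast
  show "is_component \<delta>"
  proof (cases "V = {}")
    case True
    then show ?thesis using V(2) by (simp add: is_component_def labeling_union_empty)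
  next
    case False
    then show ?thesis using V unfolding is_component_def by (metis image_is_empty image_mono)
  qed
qed

section \<open>Face and direction space of a labeling\<close>

text \<open>The inverse of \<open>face_labeling\<close>: labels that do not occur become tight
  inequalities. The empty labeling demands column sums equal to both 0 and 1, so it yields the empty
  face with no special clause.\<close>

definition labeling_face ::
    "('m :: {finite,linorder}, 'n :: {finite,linorder}) labeling \<Rightarrow> (real ^ 'n :: {finite,linorder} ^ 'm :: {finite,linorder}) set" where
  "labeling_face \<delta> =
     {M \<in> flow_polytope. \<forall>i j.
        (1 \<notin> vlab \<delta> i j \<longrightarrow> col_sum M i j = 0) \<and>
        (0 \<notin> vlab \<delta> i j \<longrightarrow> col_sum M i j = 1) \<and>
        (hlab \<delta> i j \<noteq> Star \<longrightarrow> row_sum M i j = 0)}"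

text \<open>For the labeling of a nonempty face this is the linear space parallel to the face, by
  \<open>aff_dim_face\<close>.\<close>

definition labeling_space ::
    "('m :: {finite,linorder}, 'n :: {finite,linorder}) labeling \<Rightarrow> (real ^ 'n :: {finite,linorder} ^ 'm :: {finite,linorder}) set" where
  "labeling_space \<delta> =
     {D. \<forall>i j. (vlab \<delta> i j \<noteq> {0, 1} \<longrightarrow> col_sum D i j = 0) \<and>
               (hlab \<delta> i j \<noteq> Star \<longrightarrow> row_sum D i j = 0)}"

lemma subspace_labeling_space: "subspace (labeling_space \<delta>)"
  by (rule subspaceI) (auto simp: labeling_space_def partial_sum_linear)

lemma sign_matrix_in_flow_polytope: "sign_matrix M \<Longrightarrow> M \<in> flow_polytope"
  by (simp add: extreme_point_iff_sign_matrix[symmetric] extreme_point_of_def)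

lemma sign_matrix_in_labeling_face:
  assumes "V \<subseteq> {M. sign_matrix M}" "M \<in> V"
  shows "M \<in> labeling_face (labeling_union (zero_dim_component ` V))"
proof -
  have "sign_matrix M" using assms by blast
  then have "M \<in> flow_polytope" "\<And>i j. col_sum M i j = 0 \<or> col_sum M i j = 1"
    by (simp_all add: sign_matrix_in_flow_polytope) (simp add: sign_matrix_def)
  moreover have "\<And>i j. col_sum M i j \<in> vlab (labeling_union (zero_dim_component ` V)) i j"
    "\<And>i j. hlab (labeling_union (zero_dim_component ` V)) i j \<noteq> Star \<Longrightarrow> row_sum M i j = 0"
    unfolding zero_dim_component_union using assms(2) by blast+
  ultimately show ?thesis unfolding labeling_face_def by (auto, metis, metis)
qed

text \<open>Each defining equation is an inequality of the polytope made tight, and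
  \<open>convex_comb_nonneg_0\<close> carries tightness to the ends of a segment.\<close>

lemma labeling_face_face_of: "labeling_face \<delta> face_of flow_polytope"
  unfolding face_of_def
proof (intro conjI ballI impI)
  show "labeling_face \<delta> \<subseteq> flow_polytope" by (auto simp: labeling_face_def)
  show "convex (labeling_face \<delta>)"
    unfolding convex_def
  proof (intro ballI allI impI)
    fix A B and u v :: real
    assume "A \<in> labeling_face \<delta>" "B \<in> labeling_face \<delta>" "0 \<le> u" "0 \<le> v" "u + v = 1"
    moreover from this have "u *\<^sub>R A + v *\<^sub>R B \<in> flow_polytope"
      by (intro convexD[OF convex_flow_polytope]) (auto simp: labeling_face_def)
    ultimately show "u *\<^sub>R A + v *\<^sub>R B \<in> labeling_face \<delta>"
      by (auto simp: labeling_face_def partial_sum_linear)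
  qed
next
  have *: "A \<in> labeling_face \<delta> \<and> B \<in> labeling_face \<delta>"
    if AB: "A \<in> flow_polytope" "B \<in> flow_polytope" and M: "M \<in> labeling_face \<delta>" "M \<in> open_segment A B" for A B M
  proof -
    obtain u where u: "0 < u" "u < 1" "M = (1 - u) *\<^sub>R A + u *\<^sub>R B"
      using M(2) by (auto simp: in_segment)
    have c: "(1 - u) * col_sum A i j + u * col_sum B i j = col_sum M i j"
      and r: "(1 - u) * row_sum A i j + u * row_sum B i j = row_sum M i j" for i j
      by (simp_all add: u(3) partial_sum_linear)
    have b: "0 \<le> col_sum A i j" "col_sum A i j \<le> 1" "0 \<le> col_sum B i j" "col_sum B i j \<le> 1"
      "0 \<le> row_sum A i j" "0 \<le> row_sum B i j" for i j
      using AB by (simp_all add: flow_polytope_def)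
    have "col_sum M i j = 0 \<Longrightarrow> col_sum A i j = 0 \<and> col_sum B i j = 0" for i j
      by (rule convex_comb_nonneg_0[OF u(1,2) b(1,3)]) (simp add: c)
    moreover have "col_sum M i j = 1 \<Longrightarrow> 1 - col_sum A i j = 0 \<and> 1 - col_sum B i j = 0" for i j
      by (rule convex_comb_nonneg_0[OF u(1,2)]) (use b[of i j] c[of i j] in \<open>simp_all add: algebra_simps\<close>)
    moreover have "row_sum M i j = 0 \<Longrightarrow> row_sum A i j = 0 \<and> row_sum B i j = 0" for i j
      by (rule convex_comb_nonneg_0[OF u(1,2) b(5,6)]) (simp add: r)
    ultimately show ?thesis
      using M(1) AB by (simp add: labeling_face_def)
  qed
  fix A B M
  assume "A \<in> flow_polytope" "B \<in> flow_polytope" "M \<in> labeling_face \<delta>" "M \<in> open_segment A B"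
  from *[OF this] show "A \<in> labeling_face \<delta>" "B \<in> labeling_face \<delta>" by blast+
qed

lemma labeling_face_mono:
  assumes "contained_in \<delta> \<delta>'"
  shows "labeling_face \<delta> \<subseteq> labeling_face \<delta>'"
proof
  fix M assume M: "M \<in> labeling_face \<delta>"
  have "vlab \<delta> i j \<subseteq> vlab \<delta>' i j" "hlab \<delta>' i j \<noteq> Star \<Longrightarrow> hlab \<delta> i j \<noteq> Star" for i j
    using assms[unfolded contained_in_def, rule_format, of i j] by (auto simp: hlabel_le_def)
  with M show "M \<in> labeling_face \<delta>'" unfolding labeling_face_def by blast
qed

lemma hlabel_leI: "(x = Star \<Longrightarrow> y = Star) \<Longrightarrow> (y = NoLabel \<Longrightarrow> x = NoLabel) \<Longrightarrow> hlabel_le x y"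
  by (cases x; cases y) (auto simp: hlabel_le_def)

lemma labeling_union_mono:
  assumes "V \<subseteq> V'"
  shows "contained_in (labeling_union (zero_dim_component ` V)) (labeling_union (zero_dim_component ` V'))"
  unfolding contained_in_def
proof (intro allI conjI)
  fix i j
  show "vlab (labeling_union (zero_dim_component ` V)) i j \<subseteq> vlab (labeling_union (zero_dim_component ` V')) i j"
    unfolding zero_dim_component_union using assms by blast
  show "hlabel_le (hlab (labeling_union (zero_dim_component ` V)) i j) (hlab (labeling_union (zero_dim_component ` V')) i j)"
    by (rule hlabel_leI) (use assms in \<open>auto simp only: zero_dim_component_union\<close>)
qed

text \<open>Extreme points of a face are the extreme points of the polytope that lie in it.\<close>

lemma extreme_point_of_face_iff:
  assumes "F face_of flow_polytope"
  shows "{M. sign_matrix M \<and> M extreme_point_of F} = {M. sign_matrix M \<and> M \<in> F}"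
  using extreme_point_of_face[OF assms] by (auto simp: extreme_point_iff_sign_matrix)

lemma face_labeling_eq:
  assumes "F face_of flow_polytope"
  shows "face_labeling F = labeling_union (zero_dim_component ` {M. sign_matrix M \<and> M \<in> F})"
  unfolding face_labeling_def extreme_point_of_face_iff[OF assms] ..

lemma face_eq_hull:
  assumes "F face_of flow_polytope"
  shows "F = convex hull {M. sign_matrix M \<and> M \<in> F}"
proof -
  have "compact F" "convex F"
    using assms face_of_imp_compact[OF convex_flow_polytope compact_flow_polytope] face_of_imp_convex by blast+
  then have "F = convex hull {M. M extreme_point_of F}" by (rule Krein_Milman_Minkowski)
  also have "{M. M extreme_point_of F} = {M. sign_matrix M \<and> M \<in> F}"
    using extreme_point_of_face[OF assms] by (auto simp: extreme_point_iff_sign_matrix)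
  finally show ?thesis .
qed

text \<open>The face may contain more sign matrices than those that generate the component, but its
  equations admit no partial sum that would add a label.\<close>

lemma face_labeling_labeling_face:
  assumes "is_component \<delta>"
  shows "face_labeling (labeling_face \<delta>) = \<delta>"
proof -
  obtain V where V: "V \<subseteq> {M. sign_matrix M}" and \<delta>: "\<delta> = labeling_union (zero_dim_component ` V)"
    using assms by (auto simp: is_component_iff)
  define V' where "V' = {M. sign_matrix M \<and> M \<in> labeling_face \<delta>}"
  have "V \<subseteq> V'" using V sign_matrix_in_labeling_face[OF V] by (auto simp: V'_def \<delta>)
  have V': "col_sum M i j \<in> vlab \<delta> i j" "row_sum M i j \<noteq> 0 \<Longrightarrow> hlab \<delta> i j = Star"
    if "M \<in> V'" for M i j
  proof -
    have "col_sum M i j = 0 \<or> col_sum M i j = 1" using that by (simp add: V'_def sign_matrix_def)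
    moreover have L: "0 \<notin> vlab \<delta> i j \<longrightarrow> col_sum M i j = 1" "1 \<notin> vlab \<delta> i j \<longrightarrow> col_sum M i j = 0"
      "hlab \<delta> i j \<noteq> Star \<longrightarrow> row_sum M i j = 0"
      using that by (simp_all add: V'_def labeling_face_def)
    ultimately show "col_sum M i j \<in> vlab \<delta> i j" by auto
    show "row_sum M i j \<noteq> 0 \<Longrightarrow> hlab \<delta> i j = Star" using L(3) by blast
  qed
  have "V' = {}" if "V = {}"
    using V'(1) that unfolding \<delta> zero_dim_component_union by blast
  have "labeling_union (zero_dim_component ` V') = \<delta>"
  proof (rule labeling_eqI)
    fix i j
    show "vlab (labeling_union (zero_dim_component ` V')) i j = vlab \<delta> i j"
      using V'(1)[of _ i j] \<open>V \<subseteq> V'\<close> unfolding zero_dim_component_union \<delta> by blast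
    show "hlab (labeling_union (zero_dim_component ` V')) i j = Star \<longleftrightarrow> hlab \<delta> i j = Star"
      using V'(2)[of _ i j] \<open>V \<subseteq> V'\<close> unfolding zero_dim_component_union \<delta> by blast
    show "hlab (labeling_union (zero_dim_component ` V')) i j = NoLabel \<longleftrightarrow> hlab \<delta> i j = NoLabel"
      using \<open>V \<subseteq> V'\<close> \<open>V = {} \<Longrightarrow> V' = {}\<close> unfolding zero_dim_component_union \<delta> by blast
  qed
  then show ?thesis by (simp add: face_labeling_eq[OF labeling_face_face_of] V'_def)
qed

text \<open>The average of the vertices of a face lies in its relative interior.\<close>

lemma face_interior_point:
  assumes F: "F face_of flow_polytope" and "F \<noteq> {}"
  obtains X where "X \<in> F"
    and "\<And>D. D \<in> labeling_space (face_labeling F) \<Longrightarrow>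
           \<exists>e > 0. X + e *\<^sub>R D \<in> flow_polytope \<and> X - e *\<^sub>R D \<in> flow_polytope"
proof -
  define V where "V = {M. sign_matrix M \<and> M \<in> F}"
  define X where "X = (\<Sum>M\<in>V. (1 / card V) *\<^sub>R M)"
  have fin: "finite V" by (rule finite_subset[OF _ finite_sign_matrices]) (auto simp: V_def)
  have "F = convex hull V" using face_eq_hull[OF F] by (simp add: V_def)
  then have "V \<noteq> {}" using \<open>F \<noteq> {}\<close> by auto
  then have card: "card V > 0" using fin by (simp add: card_gt_0_iff)
  have "(\<Sum>M\<in>V. 1 / card V) = (1 :: real)" using card by simp
  moreover have "V \<subseteq> F" by (auto simp: V_def)
  ultimately have "X \<in> F"
    unfolding X_def by (intro convex_sum[OF fin face_of_imp_convex[OF F]]) auto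
  have \<delta>: "face_labeling F = labeling_union (zero_dim_component ` V)"
    by (simp add: face_labeling_eq[OF F] V_def)
  have X: "col_sum X i j = (\<Sum>M\<in>V. (1 / card V) * col_sum M i j)"
    "row_sum X i j = (\<Sum>M\<in>V. (1 / card V) * row_sum M i j)" for i j
    by (simp_all add: X_def partial_sum_linear)
  have V: "col_sum M i j = 0 \<or> col_sum M i j = 1" "0 \<le> row_sum M i j" if "M \<in> V" for M i j
    using that by (simp_all add: V_def sign_matrix_def)
  have col: "0 < col_sum X i j \<and> col_sum X i j < 1"
    if "D \<in> labeling_space (face_labeling F)" "col_sum D i j \<noteq> 0" for D i j
  proof -
    \<comment> \<open>D can move this column sum only if both labels occur. One vertex with sum 0
      and one with sum 1 then push the average strictly between the bounds.\<close>
    have "(\<lambda>M. col_sum M i j) ` V = {0, 1}"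
      using that unfolding labeling_space_def \<delta> zero_dim_component_union by blast
    then have "0 \<in> (\<lambda>M. col_sum M i j) ` V" "1 \<in> (\<lambda>M. col_sum M i j) ` V" by simp_all
    then obtain A B where AB: "A \<in> V" "B \<in> V" "col_sum A i j = 0" "col_sum B i j = 1"
      by (elim imageE) metis
    have V': "0 \<le> col_sum M i j \<and> col_sum M i j \<le> 1" if "M \<in> V" for M
      using V(1)[OF that, of i j] by linarith
    have "0 < (\<Sum>M\<in>V. (1 / card V) * col_sum M i j)"
      by (rule sum_pos2[OF fin \<open>B \<in> V\<close>]) (simp_all add: AB(4) card V')
    moreover have "(\<Sum>M\<in>V. (1 / card V) * col_sum M i j) < (\<Sum>M\<in>V. 1 / card V)"
    proof (rule sum_strict_mono_ex1[OF fin])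
      show "\<forall>M\<in>V. (1 / card V) * col_sum M i j \<le> 1 / card V"
        using V' by (intro ballI mult_left_le) simp_all
      show "\<exists>M\<in>V. (1 / card V) * col_sum M i j < 1 / card V"
        by (intro bexI[OF _ AB(1)]) (simp add: AB(3) card)
    qed
    ultimately show ?thesis using card by (simp add: X)
  qed
  have row: "0 < row_sum X i j"
    if "D \<in> labeling_space (face_labeling F)" "row_sum D i j \<noteq> 0" for D i j
  proof -
    have "\<exists>A\<in>V. row_sum A i j \<noteq> 0"
      using that unfolding labeling_space_def \<delta> zero_dim_component_union by blast
    then obtain A where A: "A \<in> V" "row_sum A i j \<noteq> 0" by blast
    have "0 < (\<Sum>M\<in>V. (1 / card V) * row_sum M i j)"
      by (rule sum_pos2[OF fin \<open>A \<in> V\<close>]) (use V(2)[OF A(1), of i j] A(2) in \<open>simp_all add: card V(2)\<close>)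
    then show ?thesis by (simp add: X)
  qed
  have "X \<in> flow_polytope" using \<open>X \<in> F\<close> face_of_imp_subset[OF F] by blast
  show thesis
  proof (rule that[OF \<open>X \<in> F\<close>])
    fix D assume "D \<in> labeling_space (face_labeling F)"
    from flow_polytope_perturb[OF \<open>X \<in> flow_polytope\<close> col[OF this] row[OF this]]
    show "\<exists>e > 0. X + e *\<^sub>R D \<in> flow_polytope \<and> X - e *\<^sub>R D \<in> flow_polytope" by blast
  qed
qed

lemma face_subset_labeling_face:
  assumes "F face_of flow_polytope"
  shows "F \<subseteq> labeling_face (face_labeling F)"
proof -
  have "convex hull {M. sign_matrix M \<and> M \<in> F} \<subseteq> labeling_face (face_labeling F)"
    by (intro hull_minimal face_of_imp_convex[OF labeling_face_face_of])
       (unfold face_labeling_eq[OF assms], intro subsetI, rule sign_matrix_in_labeling_face, blast+)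
  then show ?thesis by (simp only: face_eq_hull[OF assms, symmetric])
qed

lemma labeling_faceD:
  assumes "M \<in> labeling_face \<delta>"
  shows "1 \<notin> vlab \<delta> i j \<Longrightarrow> col_sum M i j = 0"
    and "0 \<notin> vlab \<delta> i j \<Longrightarrow> col_sum M i j = 1"
    and "hlab \<delta> i j \<noteq> Star \<Longrightarrow> row_sum M i j = 0"
  using assms unfolding labeling_face_def by blast+

text \<open>Two points of the face agree in all partial sums that the labeling makes tight.\<close>

lemma labeling_face_diff:
  assumes F: "F face_of flow_polytope"
    and "A \<in> labeling_face (face_labeling F)" "B \<in> labeling_face (face_labeling F)"
  shows "A - B \<in> labeling_space (face_labeling F)"
proof -
  have "col_sum (A - B) i j = 0" if "vlab (face_labeling F) i j \<noteq> {0, 1}" for i j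
  proof -
    \<comment> \<open>A label set other than {0, 1} therefore misses 0 or 1, and a missing value
      forces the column sum.\<close>
    have "vlab (face_labeling F) i j \<subseteq> {0, 1}"
      unfolding face_labeling_eq[OF F] zero_dim_component_union
      by (intro image_subsetI) (simp add: sign_matrix_def del: insert_iff)
    then have "0 \<notin> vlab (face_labeling F) i j \<or> 1 \<notin> vlab (face_labeling F) i j"
      using that by blast
    then have "col_sum A i j = col_sum B i j"
      using labeling_faceD(1,2)[OF assms(2), of i j] labeling_faceD(1,2)[OF assms(3), of i j] by metis
    then show ?thesis by (simp only: linear_diff[OF linear_col_sum] diff_self)
  qed
  moreover have "row_sum (A - B) i j = 0" if "hlab (face_labeling F) i j \<noteq> Star" for i j
    unfolding linear_diff[OF linear_row_sum]
    by (simp only: labeling_faceD(3)[OF assms(2) that] labeling_faceD(3)[OF assms(3) that] diff_self)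
  ultimately show ?thesis unfolding labeling_space_def by blast
qed

lemma in_open_segment_beyond:
  fixes a x :: "'a :: real_vector"
  assumes "e > 0" "a \<noteq> x"
  shows "x \<in> open_segment a (x + e *\<^sub>R (x - a))"
proof -
  \<comment> \<open>Going from a to x is the fraction 1 / (1 + e) of the way to the far end.\<close>
  define u where "u = 1 / (1 + e)"
  have u: "0 < u" "u < 1" "u * (1 + e) = 1" using assms(1) by (simp_all add: u_def)
  have "(1 - u) *\<^sub>R a + u *\<^sub>R (x + e *\<^sub>R (x - a)) = (1 - u * (1 + e)) *\<^sub>R a + (u * (1 + e)) *\<^sub>R x"
    by (simp add: algebra_simps)
  also have "\<dots> = x" unfolding u(3) by simp
  finally have "x = (1 - u) *\<^sub>R a + u *\<^sub>R (x + e *\<^sub>R (x - a))" ..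
  moreover have "a \<noteq> x + e *\<^sub>R (x - a)"
  proof
    assume "a = x + e *\<^sub>R (x - a)"
    then have "(1 + e) *\<^sub>R (x - a) = 0" by (simp add: algebra_simps)
    then show False using assms by simp
  qed
  ultimately show ?thesis using u(1,2) unfolding in_segment by blast
qed

text \<open>From a point A of the larger set, a segment through the interior point X can be
  prolonged slightly inside the polytope. X then lies strictly between two points of the polytope,
  so the face property puts A into F.\<close>

lemma face_eq_labeling_face:
  assumes F: "F face_of flow_polytope"
  shows "labeling_face (face_labeling F) = F"
proof (cases "F = {}")
  case True
  have "labeling_face (labeling_union (zero_dim_component ` {})) = {}"
    unfolding labeling_face_def zero_dim_component_union by auto
  then show ?thesis using face_labeling_eq[OF F] True by simp
next
  case False
  show ?thesis
  proof (intro antisym face_subset_labeling_face[OF F] subsetI)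
    fix A assume A: "A \<in> labeling_face (face_labeling F)"
    obtain X where X: "X \<in> F" "\<And>D. D \<in> labeling_space (face_labeling F) \<Longrightarrow>
           \<exists>e > 0. X + e *\<^sub>R D \<in> flow_polytope \<and> X - e *\<^sub>R D \<in> flow_polytope"
      using face_interior_point[OF F False] by blast
    have "X - A \<in> labeling_space (face_labeling F)"
      using X(1) A face_subset_labeling_face[OF F] by (intro labeling_face_diff[OF F]) auto
    then obtain e where e: "e > 0" "X + e *\<^sub>R (X - A) \<in> flow_polytope" using X(2) by blast
    have "A \<in> flow_polytope" using A by (simp add: labeling_face_def)
    show "A \<in> F"
    proof (cases "A = X")
      case False
      then have "X \<in> open_segment A (X + e *\<^sub>R (X - A))" using e(1) by (intro in_open_segment_beyond)
      with F \<open>A \<in> flow_polytope\<close> e(2) X(1) show ?thesis by (blast dest: face_ofD)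
    qed (use X in simp)
  qed
qed

text \<open>At the interior point X every D of the space admits steps in both directions; as X lies
  between the two results, the face property puts them into F. Thus the differences from X span the
  space.\<close>

lemma aff_dim_face:
  assumes F: "F face_of flow_polytope" and "F \<noteq> {}"
  shows "aff_dim F = int (dim (labeling_space (face_labeling F)))"
proof -
  let ?L = "labeling_space (face_labeling F)"
  obtain X where X: "X \<in> F" "\<And>D. D \<in> ?L \<Longrightarrow>
         \<exists>e > 0. X + e *\<^sub>R D \<in> flow_polytope \<and> X - e *\<^sub>R D \<in> flow_polytope"
    using face_interior_point[OF assms] by blast
  have "span ((+) (- X) ` F) = ?L"
  proof
    have "A - X \<in> ?L" if "A \<in> F" for A
      using that X(1) face_subset_labeling_face[OF F] by (intro labeling_face_diff[OF F]) auto
    then show "span ((+) (- X) ` F) \<subseteq> ?L"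
      by (intro span_minimal subspace_labeling_space) auto
    show "?L \<subseteq> span ((+) (- X) ` F)"
    proof
      fix D assume "D \<in> ?L"
      then obtain e where e: "e > 0" "X + e *\<^sub>R D \<in> flow_polytope" "X - e *\<^sub>R D \<in> flow_polytope"
        using X(2) by blast
      show "D \<in> span ((+) (- X) ` F)"
      proof (cases "D = 0")
        case False
        then have "X \<in> open_segment (X - e *\<^sub>R D) (X + e *\<^sub>R D)" using e(1) by (intro in_open_segment_pm)
        then have "X + e *\<^sub>R D \<in> F" using face_ofD[OF F _ e(3,2) X(1)] by blast
        then have "- X + (X + e *\<^sub>R D) \<in> span ((+) (- X) ` F)" by (intro span_base imageI)
        then have "e *\<^sub>R D \<in> span ((+) (- X) ` F)" by simp
        then have "(1 / e) *\<^sub>R e *\<^sub>R D \<in> span ((+) (- X) ` F)" by (rule span_scale)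
        then show ?thesis using e(1) by simp
      qed (simp add: span_zero)
    qed
  qed
  moreover have "aff_dim F = int (dim ((+) (- X) ` F))"
    by (rule aff_dim_eq_dim) (use X(1) in \<open>simp add: hull_inc\<close>)
  ultimately show ?thesis by (metis dim_span)
qed

section \<open>The regions of the drawing\<close>

text \<open>
  \<open>on_vertical m n i j x y\<close> describes the arc of the vertical edge \<open>(i, j)\<close> including its
  prolongation. The reflection \<open>(x, y) \<mapsto> (- y, - x)\<close> exchanges rows and columns, so that
  \<open>on_vertical n m j i (- y) (- x)\<close> describes the arc of the horizontal edge \<open>(i, j)\<close>.
\<close>

definition on_vertical :: "nat \<Rightarrow> nat \<Rightarrow> nat \<Rightarrow> nat \<Rightarrow> real \<Rightarrow> real \<Rightarrow> bool" where
  "on_vertical m n i j x y \<longleftrightarrow>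
     (x = j \<and> i \<le> - y \<and> - y \<le> real i + 1) \<or>
     (i = m \<and> real n + 2 - x = (real n + 2 - j) * (y + real m + 2) \<and> 0 \<le> y + real m + 2 \<and> y + real m + 2 \<le> 1)"

lemma vertical_segment_iff:
  "(x, y) \<in> closed_segment (grid_point i j) (grid_point (i + 1) j) \<longleftrightarrow>
     x = j \<and> i \<le> - y \<and> - y \<le> real i + 1"
proof
  assume "(x, y) \<in> closed_segment (grid_point i j) (grid_point (i + 1) j)"
  then show "x = j \<and> i \<le> - y \<and> - y \<le> real i + 1"
    by (auto simp: closed_segment_def grid_point_def algebra_simps)
next
  assume "x = j \<and> i \<le> - y \<and> - y \<le> real i + 1"
  then show "(x, y) \<in> closed_segment (grid_point i j) (grid_point (i + 1) j)"
    by (auto simp: closed_segment_def grid_point_def algebra_simps intro!: exI[of _ "- y - i"])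
qed

text \<open>\<open>y + m + 2\<close> is the height above the exterior point, and by similar
  triangles the horizontal distance from that point is proportional to it, with factor
  \<open>n + 2 - j\<close>.\<close>

lemma bottom_segment_iff:
  "(x, y) \<in> closed_segment (grid_point (m + 1) j) (grid_point (m + 2) (n + 2)) \<longleftrightarrow>
     real n + 2 - x = (real n + 2 - j) * (y + real m + 2) \<and> 0 \<le> y + real m + 2 \<and> y + real m + 2 \<le> 1"
proof
  assume "(x, y) \<in> closed_segment (grid_point (m + 1) j) (grid_point (m + 2) (n + 2))"
  then obtain u :: real where u: "0 \<le> u" "u \<le> 1" "x = (1 - u) * real j + u * (2 + real n)"
      "y = (1 - u) * (- 1 - real m) + u * (- 2 - real m)"
    by (auto simp: closed_segment_def grid_point_def)
  have "y + real m + 2 = 1 - u" by (simp add: u algebra_simps)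
  moreover have "real n + 2 - x = (real n + 2 - j) * (1 - u)" by (simp add: u(3) algebra_simps)
  ultimately show "real n + 2 - x = (real n + 2 - j) * (y + real m + 2) \<and> 0 \<le> y + real m + 2 \<and> y + real m + 2 \<le> 1"
    using u(1,2) by simp
next
  assume *: "real n + 2 - x = (real n + 2 - j) * (y + real m + 2) \<and> 0 \<le> y + real m + 2 \<and> y + real m + 2 \<le> 1"
  define u where "u = 1 - (y + real m + 2)"
  have "y = (1 - u) * (- 1 - real m) + u * (- 2 - real m)" by (simp add: u_def algebra_simps)
  moreover have "x = (1 - u) * real j + u * (2 + real n)"
    using * by (simp add: u_def algebra_simps)
  ultimately show "(x, y) \<in> closed_segment (grid_point (m + 1) j) (grid_point (m + 2) (n + 2))"
    using * by (auto simp: closed_segment_def grid_point_def intro!: exI[of _ u]) (simp_all add: u_def)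
qed

definition anti_swap :: "real \<times> real \<Rightarrow> real \<times> real" where
  "anti_swap p = (- snd p, - fst p)"

text \<open>Transports facts about vertical arcs to horizontal ones.\<close>

lemma anti_swap_closed_segment: "p \<in> closed_segment a b \<longleftrightarrow> anti_swap p \<in> closed_segment (anti_swap a) (anti_swap b)"
proof -
  have "linear anti_swap" by (rule linearI) (auto simp: anti_swap_def)
  moreover have "inj anti_swap" by (rule injI) (auto simp: anti_swap_def prod_eq_iff)
  ultimately show ?thesis by (metis closed_segment_linear_image inj_image_mem_iff)
qed

lemma anti_swap_grid_point: "anti_swap (grid_point i j) = grid_point j i"
  by (simp add: anti_swap_def grid_point_def)

lemma vertical_arc_iff:
  "(x, y) \<in> vertical_arc (i :: 'm :: {finite,linorder}) (j :: 'n :: {finite,linorder}) \<longleftrightarrow>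
     on_vertical CARD('m) CARD('n) (idx i) (idx j) x y"
proof (cases "idx i = CARD('m)")
  case True
  show ?thesis
    unfolding vertical_arc_def on_vertical_def Un_iff True vertical_segment_iff
      if_P[OF refl] bottom_segment_iff by simp
next
  case False
  then show ?thesis unfolding vertical_arc_def on_vertical_def Un_iff vertical_segment_iff by simp
qed

lemma horizontal_arc_iff:
  "(x, y) \<in> horizontal_arc (i :: 'm :: {finite,linorder}) (j :: 'n :: {finite,linorder}) \<longleftrightarrow>
     on_vertical CARD('n) CARD('m) (idx j) (idx i) (- y) (- x)"
proof -
  have *: "(x, y) \<in> closed_segment (grid_point a b) (grid_point c d) \<longleftrightarrow>
      (- y, - x) \<in> closed_segment (grid_point b a) (grid_point d c)" for a b c d
    by (subst anti_swap_closed_segment) (simp add: anti_swap_grid_point, simp add: anti_swap_def)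
  show ?thesis
  proof (cases "idx j = CARD('n)")
    case True
    show ?thesis
      unfolding horizontal_arc_def on_vertical_def Un_iff True if_P[OF refl] *
        vertical_segment_iff bottom_segment_iff by simp
  next
    case False
    then show ?thesis unfolding horizontal_arc_def on_vertical_def Un_iff * vertical_segment_iff by simp
  qed
qed

lemma darkened_drawing_iff:
  fixes \<delta> :: "('m :: {finite,linorder}, 'n :: {finite,linorder}) labeling"
  shows "(x, y) \<in> darkened_drawing \<delta> \<longleftrightarrow>
    (\<exists>i j. vlab \<delta> i j = {0, 1} \<and> on_vertical CARD('m) CARD('n) (idx i) (idx j) x y) \<or>
    (\<exists>i j. hlab \<delta> i j = Star \<and> on_vertical CARD('n) CARD('m) (idx j) (idx i) (- y) (- x))"
proof -
  have "(x, y) \<in> darkened_drawing \<delta> \<longleftrightarrow>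
    (\<exists>i j. vlab \<delta> i j = {0, 1} \<and> (x, y) \<in> vertical_arc i j) \<or>
    (\<exists>i j. hlab \<delta> i j = Star \<and> (x, y) \<in> horizontal_arc i j)"
    unfolding darkened_drawing_def by blast
  then show ?thesis by (simp only: vertical_arc_iff horizontal_arc_iff)
qed

text \<open>
  In the quadrant left of and above the common exterior point, \<open>col_coord\<close> is the horizontal
  coordinate after a central projection from that point onto the line \<open>y = - (m + 1)\<close> of the part
  below this line. The corresponding row coordinate is \<open>col_coord n m (- y) (- x)\<close>. Up to clamping,
  the arcs of the drawing are the grid segments in these coordinates.
\<close>

definition col_coord :: "nat \<Rightarrow> nat \<Rightarrow> real \<Rightarrow> real \<Rightarrow> real" where
  "col_coord m n x y = real n + 2 - (real n + 2 - x) / min 1 (y + real m + 2)"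

text \<open>The alternative \<open>i = m\<close> admits row coordinates beyond m + 1, which occur on
  the prolongations.\<close>

lemma on_vertical_coords:
  assumes pos: "0 < real n + 2 - x" "0 < y + real m + 2" and "i \<le> m" "j \<le> n"
    and col: "col_coord m n x y = j"
    and row: "i \<le> col_coord n m (- y) (- x)" "col_coord n m (- y) (- x) \<le> real i + 1 \<or> i = m"
  shows "on_vertical m n i j x y"
proof (cases "y + real m + 2 \<ge> 1")
  case True
  then have x: "x = j" using col by (simp add: col_coord_def)
  \<comment> \<open>With x = j at most n, the row coordinate is not projected either.\<close>
  then have "min 1 (real n + 2 - x) = 1" using \<open>j \<le> n\<close> by simp
  then have "col_coord n m (- y) (- x) = - y" by (simp add: col_coord_def)
  then show ?thesis using row x True by (auto simp: on_vertical_def)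
next
  case False
  define a b where "a = real n + 2 - x" and "b = y + real m + 2"
  have ab: "0 < a" "0 < b" "b < 1" using pos False by (simp_all add: a_def b_def)
  have "min 1 b = b" using ab(3) by simp
  then have "col_coord m n x y = real n + 2 - a / b" by (simp add: col_coord_def a_def b_def)
  then have "a / b = real n + 2 - j" using col by linarith
  then have a: "a = (real n + 2 - j) * b" using ab(2) by (simp add: field_simps)
  \<comment> \<open>On this projected column line the point is at least twice as far from the
    exterior point horizontally as vertically. Its row coordinate then exceeds m + 1, which only the
    last row permits.\<close>
  have "2 * b \<le> (real n + 2 - j) * b" using \<open>j \<le> n\<close> ab by (intro mult_right_mono) simp_all
  then have "b < min 1 a" using a ab by simp
  then have "b / min 1 a < 1" using ab by simp
  then have "col_coord n m (- y) (- x) > real m + 1" by (simp add: col_coord_def a_def b_def algebra_simps)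
  then have "i = m" using row(2) \<open>i \<le> m\<close> by linarith
  then show ?thesis using a ab by (simp add: on_vertical_def a_def b_def)
qed

text \<open>The exterior point is the only rightmost and the only lowest point that an arc can have
  on the boundary of its quadrant, so beyond it rays to the right or downwards meet no arc.\<close>

lemma on_vertical_quadrant:
  assumes "on_vertical m n i j x y" "i \<le> m" "j \<le> n"
  shows "0 \<le> real n + 2 - x \<and> 0 \<le> y + real m + 2 \<and> (real n + 2 - x = 0 \<longleftrightarrow> y + real m + 2 = 0)"
proof -
  have n: "real n + 2 - j > 0" using assms(3) by simp
  consider "x = j" "- y \<le> real i + 1"
    | "real n + 2 - x = (real n + 2 - j) * (y + real m + 2)" "0 \<le> y + real m + 2"
    using assms(1) unfolding on_vertical_def by blast
  then show ?thesis
  proof cases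
    case 2
    then have "0 \<le> real n + 2 - x" using n by (metis less_imp_le mult_nonneg_nonneg)
    moreover have "real n + 2 - x = 0 \<longleftrightarrow> y + real m + 2 = 0" unfolding 2(1) using n by simp
    ultimately show ?thesis using 2(2) by blast
  qed (use assms(2,3) in simp)
qed

text \<open>The straight part has an integral abscissa, and the prolongation starts below all
  squares with k at most m.\<close>

lemma on_vertical_not_in_open_cell:
  assumes "k < - y" "- y < real k + 1" "l < x" "x < real l + 1" "k \<le> m" "l \<le> n"
  shows "\<not> on_vertical m n i j x y"
  using assms by (auto simp: on_vertical_def)

text \<open>The midpoint of an edge lies on no other arc, so it is a passage between two cells if
  the edge is not darkened.\<close>

lemma on_vertical_midpoint:
  assumes "on_vertical m n i' j' (real j) (- (real i + 1 / 2))" "i \<le> m"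
  shows "i' = i \<and> j' = j"
  using assms by (auto simp: on_vertical_def)

lemma on_vertical_midpoint_swap:
  assumes "j \<le> n"
  shows "\<not> on_vertical n m j' i' (real i + 1 / 2) (- real j)"
proof -
  have "real i + 1 / 2 \<noteq> real i'"
  proof
    assume "real i + 1 / 2 = real i'"
    then have "real (2 * i + 1) = real (2 * i')" by simp
    then have "2 * i + 1 = 2 * i'" by (simp only: of_nat_eq_iff)
    then show False by presburger
  qed
  then show ?thesis using assms by (auto simp: on_vertical_def)
qed

lemma on_vertical_above:
  assumes "- y < 1" "1 \<le> i" "i \<le> m" "1 \<le> j" "j \<le> n"
  shows "\<not> on_vertical m n i j x y" "\<not> on_vertical n m j i (- y) (- x)"
proof -
  show "\<not> on_vertical m n i j x y" using assms by (auto simp: on_vertical_def)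
  have "\<not> (real m + 2 - (- y) = (real m + 2 - real i) * (- x + real n + 2) \<and>
      0 \<le> - x + real n + 2 \<and> - x + real n + 2 \<le> 1)"
  proof
    assume *: "real m + 2 - (- y) = (real m + 2 - real i) * (- x + real n + 2) \<and>
      0 \<le> - x + real n + 2 \<and> - x + real n + 2 \<le> 1"
    \<comment> \<open>A prolongation of horizontal edge i descends from row i to row m + 2, so it
      never rises above row i.\<close>
    then have "(real m + 2 - i) * (- x + real n + 2) \<le> (real m + 2 - i) * 1"
      using assms by (intro mult_left_mono) simp_all
    with *[THEN conjunct1] have "real m + 2 - (- y) \<le> real m + 2 - real i" by (metis mult_1_right)
    then show False using assms(1,2) by simp
  qed
  moreover have "- y \<noteq> real i" using assms(1,2) by linarith
  ultimately show "\<not> on_vertical n m j i (- y) (- x)" unfolding on_vertical_def by blast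
qed

text \<open>
  Moving radially away from the exterior point, a point below the line \<open>y = - (m + 1)\<close> reaches this
  line before it meets an arc that it was not on from the beginning.
\<close>

lemma on_vertical_radial:
  assumes b: "0 < b" "b \<le> a" and t: "1 \<le> t" "t * b \<le> 1" and ij: "i \<le> m" "j \<le> n"
  shows "on_vertical m n i j (real n + 2 - t * a) (t * b - m - 2) \<Longrightarrow> on_vertical m n i j (real n + 2 - a) (b - m - 2)"
    and "\<not> on_vertical n m j i (- (t * b - m - 2)) (- (real n + 2 - t * a))"
proof -
  assume "on_vertical m n i j (real n + 2 - t * a) (t * b - m - 2)"
  then consider "real n + 2 - t * a = j" "- (t * b - m - 2) \<le> real i + 1"
    | "i = m" "real n + 2 - (real n + 2 - t * a) = (real n + 2 - j) * (t * b - m - 2 + m + 2)"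
    unfolding on_vertical_def by blast
  then have "i = m \<and> t * a = (real n + 2 - j) * (t * b)"
  proof cases
    case 1
    \<comment> \<open>At or below the line \<open>y = - (m + 1)\<close>, the straight part has only
      its lower end in the last row, where the prolongation begins.\<close>
    then have "t * b = 1" "i = m" using t(2) ij(1) by linarith+
    then show ?thesis using 1(1) by simp
  qed simp
  moreover from this have "t * a = t * ((real n + 2 - j) * b)" by simp
  then have "a = (real n + 2 - j) * b" using t(1) by (simp only: mult_cancel_left) simp
  moreover have "b \<le> 1" using b t mult_right_mono[of 1 t b] by linarith
  ultimately show "on_vertical m n i j (real n + 2 - a) (b - m - 2)"
    using b t by (simp add: on_vertical_def)
next
  have "t * b > 0" using b t by simp
  show "\<not> on_vertical n m j i (- (t * b - m - 2)) (- (real n + 2 - t * a))"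
  proof
    assume "on_vertical n m j i (- (t * b - m - 2)) (- (real n + 2 - t * a))"
    then consider "real m + 2 - t * b = i" | "t * b = (real m + 2 - i) * (t * a)"
      by (auto simp: on_vertical_def algebra_simps)
    then show False
    proof cases
      case 1
      then show False using t(2) ij(1) by linarith
    next
      case 2
      have "0 < t * a" using b t by simp
      \<comment> \<open>A horizontal prolongation has vertical distance at least twice the
        horizontal one, against b at most a.\<close>
      then have "2 * (t * a) \<le> (real m + 2 - i) * (t * a)" using ij by (intro mult_right_mono) simp_all
      moreover have "t * b \<le> t * a" using b t by simp
      ultimately show False using 2 \<open>0 < t * a\<close> by linarith
    qed
  qed
qed

section \<open>Locally constant extension of corner sums to the plane\<close>

text \<open>A wedge between prolongations counts as part of the cell it continues. Truncation by
  \<open>nat\<close> sends negative coordinates to row or column 0, and coordinates past the last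
  row or column repeat the last corner sum. On an arc the floor picks one side.\<close>

definition cell_value ::
    "real ^ 'n :: {finite,linorder} ^ 'm :: {finite,linorder} \<Rightarrow> real \<times> real \<Rightarrow> real" where
  "cell_value D p =
     (if 0 < real CARD('n) + 2 - fst p \<and> 0 < snd p + real CARD('m) + 2
      then corner_sum D (nat \<lfloor>col_coord CARD('n) CARD('m) (- snd p) (- fst p)\<rfloor>)
             (nat \<lfloor>col_coord CARD('m) CARD('n) (fst p) (snd p)\<rfloor>)
      else 0)"

text \<open>The factor n + 1 is the distance from the exterior point to column 1, so the hypothesis
  puts the projected point to the left of this column.\<close>

lemma col_coord_less_1:
  assumes "0 < y + real m + 2" "(real n + 1) * min 1 (y + real m + 2) < real n + 2 - x"
  shows "col_coord m n x y < 1"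
proof -
  have "0 < min 1 (y + real m + 2)" using assms by simp
  then have "real n + 1 < (real n + 2 - x) / min 1 (y + real m + 2)"
    using assms(2) by (simp add: pos_less_divide_eq)
  then show ?thesis by (simp add: col_coord_def)
qed

lemma cell_value_0_left:
  fixes D :: "real ^ 'n :: {finite,linorder} ^ 'm :: {finite,linorder}"
  assumes "(real CARD('n) + 1) * min 1 (y + real CARD('m) + 2) < real CARD('n) + 2 - x"
  shows "cell_value D (x, y) = 0"
  using col_coord_less_1[OF _ assms] by (auto simp: cell_value_def)

lemma cell_value_0_right:
  fixes D :: "real ^ 'n :: {finite,linorder} ^ 'm :: {finite,linorder}"
  assumes "(real CARD('m) + 1) * min 1 (real CARD('n) + 2 - x) < y + real CARD('m) + 2"
  shows "cell_value D (x, y) = 0"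
proof (cases "0 < real CARD('n) + 2 - x")
  case True
  then have "col_coord CARD('n) CARD('m) (- y) (- x) < 1"
    using assms by (intro col_coord_less_1) (simp_all add: algebra_simps)
  then have "nat \<lfloor>col_coord CARD('n) CARD('m) (- y) (- x)\<rfloor> = 0" by simp
  then show ?thesis by (simp add: cell_value_def)
qed (simp add: cell_value_def)

text \<open>An unbounded component contains a point beyond this crude bound; a function constant on
  the component is therefore 0 there.\<close>

lemma cell_value_nonzero_bounded:
  fixes D :: "real ^ 'n :: {finite,linorder} ^ 'm :: {finite,linorder}"
  assumes "cell_value D p \<noteq> 0"
  shows "norm p \<le> 2 * (real CARD('m) + real CARD('n) + 2)"
proof (cases p)
  case (Pair x y)
  have "0 < real CARD('n) + 2 - x" "0 < y + real CARD('m) + 2"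
    using assms by (auto simp: cell_value_def Pair split: if_splits)
  moreover have "real CARD('n) + 2 - x \<le> (real CARD('n) + 1) * 1"
  proof (rule order_trans)
    show "real CARD('n) + 2 - x \<le> (real CARD('n) + 1) * min 1 (y + real CARD('m) + 2)"
      using assms cell_value_0_left[of y x D] unfolding Pair by (rule contrapos_np) simp
    show "(real CARD('n) + 1) * min 1 (y + real CARD('m) + 2) \<le> (real CARD('n) + 1) * 1"
      by (rule mult_left_mono) simp_all
  qed
  moreover have "y + real CARD('m) + 2 \<le> (real CARD('m) + 1) * 1"
  proof (rule order_trans)
    show "y + real CARD('m) + 2 \<le> (real CARD('m) + 1) * min 1 (real CARD('n) + 2 - x)"
      using assms cell_value_0_right[of x y D] unfolding Pair by (rule contrapos_np) simp
    show "(real CARD('m) + 1) * min 1 (real CARD('n) + 2 - x) \<le> (real CARD('m) + 1) * 1"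
      by (rule mult_left_mono) simp_all
  qed
  ultimately have "\<bar>x\<bar> \<le> real CARD('m) + real CARD('n) + 2" "\<bar>y\<bar> \<le> real CARD('m) + real CARD('n) + 2"
    by (simp_all add: abs_le_iff)
  then show ?thesis using norm_Pair_le[of x y] by (simp add: Pair)
qed

text \<open>A point on an arc but off the drawing witnesses that the edge is not darkened, hence
  that the column sum of D vanishes on it.\<close>

lemma corner_sum_col_edge:
  fixes D :: "real ^ 'n :: {finite,linorder} ^ 'm :: {finite,linorder}"
  assumes "D \<in> labeling_space \<delta>" "(x, y) \<notin> darkened_drawing \<delta>"
    and "on_vertical CARD('m) CARD('n) i j x y" "1 \<le> i" "i \<le> CARD('m)" "1 \<le> j" "j \<le> CARD('n)"
  shows "corner_sum D i j = corner_sum D i (j - 1)"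
proof -
  obtain i' :: 'm where i': "idx i' = i" using assms idx_surj by blast
  obtain j' :: 'n where j': "idx j' = j" using assms idx_surj by blast
  have "vlab \<delta> i' j' \<noteq> {0, 1}" using assms(2,3) unfolding darkened_drawing_iff i'[symmetric] j'[symmetric] by blast
  then have "col_sum D i' j' = 0" using assms(1) unfolding labeling_space_def by blast
  then show ?thesis by (simp add: col_sum_corner i' j')
qed

lemma corner_sum_row_edge:
  fixes D :: "real ^ 'n :: {finite,linorder} ^ 'm :: {finite,linorder}"
  assumes "D \<in> labeling_space \<delta>" "(x, y) \<notin> darkened_drawing \<delta>"
    and "on_vertical CARD('n) CARD('m) j i (- y) (- x)" "1 \<le> i" "i \<le> CARD('m)" "1 \<le> j" "j \<le> CARD('n)"
  shows "corner_sum D i j = corner_sum D (i - 1) j"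
proof -
  obtain i' :: 'm where i': "idx i' = i" using assms idx_surj by blast
  obtain j' :: 'n where j': "idx j' = j" using assms idx_surj by blast
  have "hlab \<delta> i' j' \<noteq> Star" using assms(2,3) unfolding darkened_drawing_iff i'[symmetric] j'[symmetric] by blast
  then have "row_sum D i' j' = 0" using assms(1) unfolding labeling_space_def by blast
  then show ?thesis by (simp add: row_sum_corner i' j')
qed

lemma corner_sum_col_cross:
  fixes D :: "real ^ 'n :: {finite,linorder} ^ 'm :: {finite,linorder}"
  assumes "D \<in> labeling_space \<delta>" "(x, y) \<notin> darkened_drawing \<delta>"
    and pos: "0 < real CARD('n) + 2 - x" "0 < y + real CARD('m) + 2"
    and col: "col_coord CARD('m) CARD('n) x y = of_int l"
    and row: "of_int k \<le> col_coord CARD('n) CARD('m) (- y) (- x)"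
      "col_coord CARD('n) CARD('m) (- y) (- x) \<le> of_int k + 1"
  shows "corner_sum D (nat k) (nat l) = corner_sum D (nat k) (nat (l - 1))"
proof -
  \<comment> \<open>Only the last case crosses an actual edge; in the others both cells lie in row
    0, in column 0 or past the last column.\<close>
  consider "k \<le> 0" | "l \<le> 0" | "l > int CARD('n)" | "k > 0" "l > 0" "l \<le> int CARD('n)" by linarith
  then show ?thesis
  proof cases
    case 3
    then have "min (nat l) CARD('n) = min (nat (l - 1)) CARD('n)" by linarith
    then show ?thesis by (metis corner_sum_min_col)
  next
    case 4
    \<comment> \<open>Rows past the last one belong to the wedge of the last row, so the crossed
      edge is the one in the clamped row.\<close>
    define i where "i = min (nat k) CARD('m)"
    have i: "1 \<le> i" "i \<le> CARD('m)" using 4 by (auto simp: i_def)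
    have "real i \<le> of_int k" using 4 by (simp add: i_def)
    moreover have "i = CARD('m) \<or> real i = of_int k" using 4 by (auto simp: i_def min_def)
    ultimately have "on_vertical CARD('m) CARD('n) i (nat l) x y"
      by (intro on_vertical_coords[OF pos i(2)]) (use 4 col row in auto)
    then have "corner_sum D i (nat l) = corner_sum D i (nat l - 1)"
      using 4 by (intro corner_sum_col_edge[OF assms(1,2) _ i]) auto
    moreover have "nat l - 1 = nat (l - 1)" by simp
    ultimately show ?thesis by (simp only: i_def corner_sum_min_row)
  qed simp_all
qed

lemma corner_sum_row_cross:
  fixes D :: "real ^ 'n :: {finite,linorder} ^ 'm :: {finite,linorder}"
  assumes "D \<in> labeling_space \<delta>" "(x, y) \<notin> darkened_drawing \<delta>"
    and pos: "0 < real CARD('n) + 2 - x" "0 < y + real CARD('m) + 2"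
    and row: "col_coord CARD('n) CARD('m) (- y) (- x) = of_int k"
    and col: "of_int l \<le> col_coord CARD('m) CARD('n) x y"
      "col_coord CARD('m) CARD('n) x y \<le> of_int l + 1"
  shows "corner_sum D (nat k) (nat l) = corner_sum D (nat (k - 1)) (nat l)"
proof -
  consider "k \<le> 0" | "l \<le> 0" | "k > int CARD('m)" | "l > 0" "k > 0" "k \<le> int CARD('m)" by linarith
  then show ?thesis
  proof cases
    case 3
    then have "min (nat k) CARD('m) = min (nat (k - 1)) CARD('m)" by linarith
    then show ?thesis by (metis corner_sum_min_row)
  next
    case 4
    define j where "j = min (nat l) CARD('n)"
    have j: "1 \<le> j" "j \<le> CARD('n)" using 4 by (auto simp: j_def)
    have "real j \<le> of_int l" using 4 by (simp add: j_def)
    moreover have "j = CARD('n) \<or> real j = of_int l" using 4 by (auto simp: j_def min_def)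
    ultimately have "on_vertical CARD('n) CARD('m) j (nat k) (- y) (- x)"
      by (intro on_vertical_coords[OF _ _ j(2)]) (use pos 4 col row in auto)
    then have "corner_sum D (nat k) j = corner_sum D (nat k - 1) j"
      using 4 j by (intro corner_sum_row_edge[OF assms(1,2)]) auto
    moreover have "nat k - 1 = nat (k - 1)" by simp
    ultimately show ?thesis by (simp only: j_def corner_sum_min_col)
  qed simp_all
qed

text \<open>The floor is constant near a non-integer, and near an integer it can only drop by
  one.\<close>

lemma eventually_floor:
  fixes f :: "'a \<Rightarrow> real"
  assumes "(f \<longlongrightarrow> u) F"
  shows "eventually (\<lambda>q. \<lfloor>f q\<rfloor> = \<lfloor>u\<rfloor> \<or> (of_int \<lfloor>u\<rfloor> = u \<and> \<lfloor>f q\<rfloor> = \<lfloor>u\<rfloor> - 1)) F"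
proof -
  have "eventually (\<lambda>q. of_int (\<lceil>u\<rceil> - 1) < f q) F" "eventually (\<lambda>q. f q < of_int (\<lfloor>u\<rfloor> + 1)) F"
    by (intro order_tendstoD[OF assms]; linarith)+
  then show ?thesis
  proof eventually_elim
    case (elim q)
    then have "\<lceil>u\<rceil> - 1 \<le> \<lfloor>f q\<rfloor>" "\<lfloor>f q\<rfloor> \<le> \<lfloor>u\<rfloor>" by linarith+
    moreover have "\<lceil>u\<rceil> = (if of_int \<lfloor>u\<rfloor> = u then \<lfloor>u\<rfloor> else \<lfloor>u\<rfloor> + 1)"
      by (metis ceiling_altdef)
    ultimately show ?case by (auto split: if_splits)
  qed
qed

text \<open>The cases are an open region where the value is 0, the exterior point, and the open
  quadrant. In the quadrant the coordinates are continuous, and a jump of a floor means that the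
  base point lies on a grid line in these coordinates.\<close>

lemma cell_value_locally_constant:
  fixes D :: "real ^ 'n :: {finite,linorder} ^ 'm :: {finite,linorder}"
  assumes D: "D \<in> labeling_space \<delta>" and p: "(x, y) \<notin> darkened_drawing \<delta>"
  shows "eventually (\<lambda>q. cell_value D (x, y) = cell_value D q) (at (x, y) within S)"
proof -
  let ?m = "CARD('m)" and ?n = "CARD('n)"
  let ?F = "at (x, y) within S"
  let ?a = "\<lambda>q. real ?n + 2 - fst q" and ?b = "\<lambda>q. snd q + real ?m + 2"
  have lim_fst: "(fst \<longlongrightarrow> x) ?F" and lim_snd: "(snd \<longlongrightarrow> y) ?F"
    by (auto intro!: tendsto_eq_intros)
  note lims = tendsto_diff[OF tendsto_const lim_fst, of "real ?n + 2"]
    tendsto_add[OF tendsto_add[OF lim_snd tendsto_const] tendsto_const, of "real ?m" 2]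
  have zero: "cell_value D q = 0"
    if "?b q > (real ?m + 1) * ?a q \<or> ?a q > (real ?n + 1) * ?b q \<or> ?a q < 0 \<or> ?b q < 0" for q
  proof -
    obtain u v where q: "q = (u, v)" by (cases q)
    have *: "k * min 1 c \<le> k * c" if "k \<ge> 0" for k c :: real
      using that by (intro mult_left_mono) simp_all
    have "cell_value D q = 0" if "?b q > (real ?m + 1) * ?a q"
    proof -
      have "(real ?m + 1) * min 1 (real ?n + 2 - u) < v + real ?m + 2"
        using le_less_trans[OF * that] by (simp add: q)
      then show ?thesis using cell_value_0_right q by blast
    qed
    moreover have "cell_value D q = 0" if "?a q > (real ?n + 1) * ?b q"
    proof -
      have "(real ?n + 1) * min 1 (v + real ?m + 2) < real ?n + 2 - u"
        using le_less_trans[OF * that] by (simp add: q)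
      then show ?thesis using cell_value_0_left q by blast
    qed
    moreover have "cell_value D q = 0" if "?a q < 0 \<or> ?b q < 0" using that by (auto simp: cell_value_def)
    ultimately show ?thesis using that by blast
  qed
  consider "?b (x, y) > (real ?m + 1) * ?a (x, y) \<or> ?a (x, y) > (real ?n + 1) * ?b (x, y) \<or>
      ?a (x, y) < 0 \<or> ?b (x, y) < 0"
    | "?a (x, y) = 0" "?b (x, y) = 0" | "?a (x, y) > 0" "?b (x, y) > 0"
  proof -
    assume 1: "?b (x, y) > (real ?m + 1) * ?a (x, y) \<or> ?a (x, y) > (real ?n + 1) * ?b (x, y) \<or>
      ?a (x, y) < 0 \<or> ?b (x, y) < 0 \<Longrightarrow> thesis"
      and 2: "?a (x, y) = 0 \<Longrightarrow> ?b (x, y) = 0 \<Longrightarrow> thesis"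
      and 3: "?a (x, y) > 0 \<Longrightarrow> ?b (x, y) > 0 \<Longrightarrow> thesis"
    show thesis
    proof (cases "?a (x, y) = 0 \<or> ?b (x, y) = 0")
      case True
      then show thesis using 1 2 by fastforce
    next
      case False
      then show thesis using 1 3 by linarith
    qed
  qed
  then show ?thesis
  proof cases
    case 1
    have "eventually (\<lambda>q. ?b q > (real ?m + 1) * ?a q \<or> ?a q > (real ?n + 1) * ?b q \<or>
        ?a q < 0 \<or> ?b q < 0) ?F"
      using 1
    proof (elim disjE)
      assume "?b (x, y) > (real ?m + 1) * ?a (x, y)"
      then have "eventually (\<lambda>q. 0 < ?b q - (real ?m + 1) * ?a q) ?F"
        by (intro order_tendstoD(1)[OF tendsto_diff[OF lims(2) tendsto_mult[OF tendsto_const lims(1)]]]) simp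
      then show ?thesis by (rule eventually_mono) simp
    next
      assume "?a (x, y) > (real ?n + 1) * ?b (x, y)"
      then have "eventually (\<lambda>q. 0 < ?a q - (real ?n + 1) * ?b q) ?F"
        by (intro order_tendstoD(1)[OF tendsto_diff[OF lims(1) tendsto_mult[OF tendsto_const lims(2)]]]) simp
      then show ?thesis by (rule eventually_mono) simp
    next
      assume "?a (x, y) < 0"
      then have "eventually (\<lambda>q. ?a q < 0) ?F" by (intro order_tendstoD(2)[OF lims(1)]) simp
      then show ?thesis by (rule eventually_mono) simp
    next
      assume "?b (x, y) < 0"
      then have "eventually (\<lambda>q. ?b q < 0) ?F" by (intro order_tendstoD(2)[OF lims(2)]) simp
      then show ?thesis by (rule eventually_mono) simp
    qed
    then show ?thesis by (rule eventually_mono) (use zero 1 in simp)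
  next
    case 2
    \<comment> \<open>All boundary edges end at the exterior point. If it is off the drawing, none
      of them is darkened, and the corner sums vanish along the last row and column.\<close>
    have xy: "x = real ?n + 2" "y = - real ?m - 2" using 2 by simp_all
    have last_col: "corner_sum D i ?n = 0" if "i \<le> ?m" for i
      using that
    proof (induction i)
      case (Suc i)
      have "corner_sum D (Suc i) ?n = corner_sum D (Suc i - 1) ?n"
        using Suc.prems by (intro corner_sum_row_edge[OF D p]) (simp_all add: on_vertical_def xy)
      with Suc show ?case by simp
    qed simp
    have last_row: "corner_sum D ?m j = 0" if "j \<le> ?n" for j
      using that
    proof (induction j)
      case (Suc j)
      have "corner_sum D ?m (Suc j) = corner_sum D ?m (Suc j - 1)"
        using Suc.prems by (intro corner_sum_col_edge[OF D p]) (simp_all add: on_vertical_def xy)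
      with Suc show ?case by simp
    qed simp
    have corner_0: "corner_sum D i j = 0" if "i \<ge> ?m \<or> j \<ge> ?n" for i j
      using that
    proof
      assume "?m \<le> i"
      then have "corner_sum D i j = corner_sum D ?m (min j ?n)"
        by (metis corner_sum_min_row corner_sum_min_col min.absorb2)
      then show ?thesis using last_row by simp
    next
      assume "?n \<le> j"
      then have "corner_sum D i j = corner_sum D (min i ?m) ?n"
        by (metis corner_sum_min_row corner_sum_min_col min.absorb2)
      then show ?thesis using last_col by simp
    qed
    have "eventually (\<lambda>q. ?a q < 1) ?F" "eventually (\<lambda>q. ?b q < 1) ?F"
      using 2 by (intro order_tendstoD(2)[OF lims(1)] order_tendstoD(2)[OF lims(2)]; simp)+
    then show ?thesis
    proof eventually_elim
      case (elim q)
      have "cell_value D q = 0"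
      proof (cases "0 < ?a q \<and> 0 < ?b q")
        case True
        \<comment> \<open>Both distances are below 1, and the smaller divided by the larger is at
          most 1, so q lies in the last row or the last column.\<close>
        have "col_coord ?n ?m (- snd q) (- fst q) \<ge> real ?m \<or> col_coord ?m ?n (fst q) (snd q) \<ge> real ?n"
        proof (cases "?b q \<le> ?a q")
          case True
          then have "?b q / ?a q \<le> 1" using \<open>0 < ?a q \<and> 0 < ?b q\<close> by simp
          then show ?thesis using elim by (simp add: col_coord_def min_def algebra_simps)
        next
          case False
          then have "?a q / ?b q \<le> 1" using \<open>0 < ?a q \<and> 0 < ?b q\<close> by simp
          then show ?thesis using elim by (simp add: col_coord_def min_def algebra_simps)
        qed
        then have "nat \<lfloor>col_coord ?n ?m (- snd q) (- fst q)\<rfloor> \<ge> ?m \<or> nat \<lfloor>col_coord ?m ?n (fst q) (snd q)\<rfloor> \<ge> ?n"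
          by (auto simp: le_nat_iff le_floor_iff)
        then show ?thesis by (simp add: cell_value_def corner_0)
      qed (auto simp: cell_value_def)
      moreover have "cell_value D (x, y) = 0" using 2 by (simp add: cell_value_def)
      ultimately show ?case by simp
    qed
  next
    case 3
    have min_lim: "((\<lambda>q. min 1 (?a q)) \<longlongrightarrow> min 1 (real ?n + 2 - x)) ?F"
      "((\<lambda>q. min 1 (?b q)) \<longlongrightarrow> min 1 (y + real ?m + 2)) ?F"
      by (intro tendsto_min tendsto_const lims)+
    have nz: "min 1 (real ?n + 2 - x) \<noteq> 0" "min 1 (y + real ?m + 2) \<noteq> 0"
      using 3 by (auto simp: min_def)
    let ?v = "\<lambda>q. col_coord ?m ?n (fst q) (snd q)" and ?u = "\<lambda>q. col_coord ?n ?m (- snd q) (- fst q)"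
    have v: "(?v \<longlongrightarrow> col_coord ?m ?n x y) ?F"
      unfolding col_coord_def by (intro tendsto_diff tendsto_const tendsto_divide min_lim nz lims)
    have "((\<lambda>q. real ?m + 2 - ?b q / min 1 (?a q)) \<longlongrightarrow>
        real ?m + 2 - (y + real ?m + 2) / min 1 (real ?n + 2 - x)) ?F"
      by (intro tendsto_diff tendsto_const tendsto_divide min_lim nz lims)
    then have u: "(?u \<longlongrightarrow> col_coord ?n ?m (- y) (- x)) ?F"
      by (simp add: col_coord_def algebra_simps)
    have "eventually (\<lambda>q. 0 < ?a q) ?F" "eventually (\<lambda>q. 0 < ?b q) ?F"
      using 3 by (intro order_tendstoD(1)[OF lims(1)] order_tendstoD(1)[OF lims(2)]; simp)+
    with eventually_floor[OF u] eventually_floor[OF v] show ?thesis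
    proof eventually_elim
      case (elim q)
      let ?k = "\<lfloor>col_coord ?n ?m (- y) (- x)\<rfloor>" and ?l = "\<lfloor>col_coord ?m ?n x y\<rfloor>"
      have pos: "0 < real ?n + 2 - x" "0 < y + real ?m + 2" using 3 by simp_all
      \<comment> \<open>First the column changes while the row of q is kept, then the row. Each
        change crosses at most one line, and this line passes through the base point.\<close>
      have "corner_sum D (nat \<lfloor>?u q\<rfloor>) (nat \<lfloor>?v q\<rfloor>) = corner_sum D (nat \<lfloor>?u q\<rfloor>) (nat ?l)"
      proof (cases "\<lfloor>?v q\<rfloor> = ?l")
        case False
        then have l: "of_int ?l = col_coord ?m ?n x y" "\<lfloor>?v q\<rfloor> = ?l - 1" using elim(2) by auto
        have "corner_sum D (nat \<lfloor>?u q\<rfloor>) (nat ?l) = corner_sum D (nat \<lfloor>?u q\<rfloor>) (nat (?l - 1))"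
        proof (rule corner_sum_col_cross[OF D p pos l(1)[symmetric]])
          show "of_int \<lfloor>?u q\<rfloor> \<le> col_coord ?n ?m (- y) (- x)"
            "col_coord ?n ?m (- y) (- x) \<le> of_int \<lfloor>?u q\<rfloor> + 1"
            using elim(1) by linarith+
        qed
        then show ?thesis using l(2) by simp
      qed simp
      also have "\<dots> = corner_sum D (nat ?k) (nat ?l)"
      proof (cases "\<lfloor>?u q\<rfloor> = ?k")
        case False
        then have k: "of_int ?k = col_coord ?n ?m (- y) (- x)" "\<lfloor>?u q\<rfloor> = ?k - 1" using elim(1) by auto
        have "corner_sum D (nat ?k) (nat ?l) = corner_sum D (nat (?k - 1)) (nat ?l)"
          by (rule corner_sum_row_cross[OF D p pos k(1)[symmetric]]) linarith+
        then show ?thesis using k(2) by simp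
      qed simp
      finally show ?case using elim(3,4) 3 by (simp add: cell_value_def)
    qed
  qed
qed

lemma cell_value_constant:
  fixes D :: "real ^ 'n :: {finite,linorder} ^ 'm :: {finite,linorder}"
  assumes "D \<in> labeling_space \<delta>" "connected C" "C \<subseteq> - darkened_drawing \<delta>" "p \<in> C" "q \<in> C"
  shows "cell_value D p = cell_value D q"
proof (rule connected_local_const[OF assms(2,4,5)], rule ballI)
  fix p assume "p \<in> C"
  then have "p \<notin> darkened_drawing \<delta>" using assms(3) by blast
  then show "eventually (\<lambda>b. cell_value D p = cell_value D b) (at p within C)"
    using cell_value_locally_constant[OF assms(1), of "fst p" "snd p"] by simp
qed

section \<open>Paths off the drawing and cell centres\<close>

definition cell_center :: "nat \<Rightarrow> nat \<Rightarrow> real \<times> real" where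
  "cell_center k l = (real l + 1 / 2, - (real k + 1 / 2))"

lemma not_in_darkened_drawingI:
  fixes \<delta> :: "('m :: {finite,linorder}, 'n :: {finite,linorder}) labeling"
  assumes "\<And>i j. 1 \<le> i \<Longrightarrow> i \<le> CARD('m) \<Longrightarrow> 1 \<le> j \<Longrightarrow> j \<le> CARD('n) \<Longrightarrow>
      \<not> on_vertical CARD('m) CARD('n) i j x y \<and> \<not> on_vertical CARD('n) CARD('m) j i (- y) (- x)"
  shows "(x, y) \<notin> darkened_drawing \<delta>"
  using assms[OF idx_ge_1 idx_le_CARD idx_ge_1 idx_le_CARD] unfolding darkened_drawing_iff by blast

text \<open>On the segment to the centre every point except the start lies in the open square, which
  no arc meets.\<close>

lemma connected_component_cell_center:
  fixes \<delta> :: "('m :: {finite,linorder}, 'n :: {finite,linorder}) labeling"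
  assumes p: "(x, y) \<notin> darkened_drawing \<delta>"
    and kl: "k \<le> CARD('m)" "l \<le> CARD('n)"
    and "real k \<le> - y" "- y \<le> real k + 1" "real l \<le> x" "x \<le> real l + 1"
  shows "connected_component (- darkened_drawing \<delta>) (x, y) (cell_center k l)"
  unfolding connected_component_def
proof (intro exI conjI)
  show "connected (closed_segment (x, y) (cell_center k l))" by simp
  show "closed_segment (x, y) (cell_center k l) \<subseteq> - darkened_drawing \<delta>"
  proof
    fix q assume "q \<in> closed_segment (x, y) (cell_center k l)"
    then obtain t where t: "0 \<le> t" "t \<le> 1" "q = ((1 - t) * x + t * (l + 1 / 2), (1 - t) * y - t * (k + 1 / 2))"
      by (auto simp: closed_segment_def cell_center_def algebra_simps)
    have strict: "c < (1 - t) * z + t * (c + 1 / 2) \<and> (1 - t) * z + t * (c + 1 / 2) < c + 1"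
      if "0 < t" "c \<le> z" "z \<le> c + 1" for c z :: real
    proof -
      have "(1 - t) * c \<le> (1 - t) * z" "(1 - t) * z \<le> (1 - t) * (c + 1)"
        using t that by (intro mult_left_mono; simp)+
      then show ?thesis using that by (simp add: algebra_simps)
    qed
    show "q \<in> - darkened_drawing \<delta>"
    proof (cases "t = 0")
      case False
      then have "0 < t" using t by simp
      define u v where "u = (1 - t) * x + t * (l + 1 / 2)" and "v = (1 - t) * y - t * (k + 1 / 2)"
      have u: "real l < u" "u < real l + 1" using strict[of l x] \<open>0 < t\<close> assms by (simp_all add: u_def)
      have "- v = (1 - t) * (- y) + t * (real k + 1 / 2)" by (simp add: v_def algebra_simps)
      then have v: "real k < - v" "- v < real k + 1" using strict[of k "- y"] \<open>0 < t\<close> assms by simp_all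
      have "(u, v) \<notin> darkened_drawing \<delta>"
        by (intro not_in_darkened_drawingI conjI on_vertical_not_in_open_cell[OF v u kl]
            on_vertical_not_in_open_cell[OF _ _ v kl(2,1)]) (use u in simp_all)
      then show ?thesis by (simp add: t(3) u_def v_def)
    qed (use t p in simp)
  qed
qed auto

lemma unbounded_component_ray:
  fixes p d :: "'a :: real_normed_vector"
  assumes "d \<noteq> 0" "\<And>t. 0 \<le> t \<Longrightarrow> p + t *\<^sub>R d \<in> S"
  shows "\<not> bounded (connected_component_set S p)"
proof
  assume "bounded (connected_component_set S p)"
  let ?R = "(\<lambda>t. p + t *\<^sub>R d) ` {0..}"
  have "connected ?R" by (intro connected_continuous_image continuous_intros) auto
  moreover have "p \<in> ?R" by (rule image_eqI[of _ _ 0]) simp_all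
  ultimately have "?R \<subseteq> connected_component_set S p"
    using assms(2) by (intro connected_component_maximal) auto
  then have "bounded ?R" using \<open>bounded (connected_component_set S p)\<close> bounded_subset by blast
  then obtain B where B: "norm (p + t *\<^sub>R d) \<le> B" if "0 \<le> t" for t
    unfolding bounded_iff by auto
  define t where "t = (\<bar>B\<bar> + norm p + 1) / norm d"
  have "norm (t *\<^sub>R d) \<le> norm (p + t *\<^sub>R d) + norm p"
    by (metis add_diff_cancel_left' norm_triangle_ineq4 add.commute)
  also have "\<dots> \<le> B + norm p" using B[of t] by (simp add: t_def)
  finally show False using assms(1) by (simp add: t_def)
qed

lemma unbounded_above:
  assumes "- y < 1"
  shows "\<not> bounded (connected_component_set (- darkened_drawing \<delta>) (x, y))"
proof (rule unbounded_component_ray[of "(0, 1)"])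
  fix t :: real assume "0 \<le> t"
  then have "(x, y + t) \<notin> darkened_drawing \<delta>"
    using assms by (intro not_in_darkened_drawingI conjI on_vertical_above) simp_all
  then show "(x, y) + t *\<^sub>R (0, 1) \<in> - darkened_drawing \<delta>" by simp
qed (simp add: zero_prod_def)

lemma unbounded_left:
  assumes "x < 1"
  shows "\<not> bounded (connected_component_set (- darkened_drawing \<delta>) (x, y))"
proof (rule unbounded_component_ray[of "(-1, 0)"])
  fix t :: real assume "0 \<le> t"
  \<comment> \<open>Left of column 1 is the mirror image of above row 1, so the two halves of
    \<open>on_vertical_above\<close> exchange roles.\<close>
  have "\<not> on_vertical m n i j (x - t) y" if "1 \<le> i" "i \<le> m" "1 \<le> j" "j \<le> n" for m n i j
    using on_vertical_above(2)[of "t - x" j n i m "- y"] that assms \<open>0 \<le> t\<close> by simp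
  moreover have "\<not> on_vertical n m j i (- y) (- (x - t))" if "1 \<le> i" "i \<le> m" "1 \<le> j" "j \<le> n" for m n i j
    using on_vertical_above(1)[of "t - x" j n i m "- y"] that assms \<open>0 \<le> t\<close> by simp
  ultimately have "(x - t, y) \<notin> darkened_drawing \<delta>" by (intro not_in_darkened_drawingI conjI)
  then show "(x, y) + t *\<^sub>R (-1, 0) \<in> - darkened_drawing \<delta>" by simp
qed (simp add: zero_prod_def)

lemma darkened_drawing_quadrant:
  fixes \<delta> :: "('m :: {finite,linorder}, 'n :: {finite,linorder}) labeling"
  assumes "(x, y) \<in> darkened_drawing \<delta>"
  shows "0 \<le> real CARD('n) + 2 - x \<and> 0 \<le> y + real CARD('m) + 2 \<and>
    (real CARD('n) + 2 - x = 0 \<longleftrightarrow> y + real CARD('m) + 2 = 0)"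
proof -
  from assms consider i j where "on_vertical CARD('m) CARD('n) (idx (i :: 'm)) (idx (j :: 'n)) x y"
    | i j where "on_vertical CARD('n) CARD('m) (idx (j :: 'n)) (idx (i :: 'm)) (- y) (- x)"
    unfolding darkened_drawing_iff by blast
  then show ?thesis
  proof cases
    case 1
    then show ?thesis by (rule on_vertical_quadrant[OF _ idx_le_CARD idx_le_CARD])
  next
    case 2
    then show ?thesis
      using on_vertical_quadrant[OF 2 idx_le_CARD idx_le_CARD] by (simp add: algebra_simps)
  qed
qed

lemma unbounded_right:
  fixes \<delta> :: "('m :: {finite,linorder}, 'n :: {finite,linorder}) labeling"
  assumes p: "(x, y) \<notin> darkened_drawing \<delta>" and "real CARD('n) + 2 - x \<le> 0"
  shows "\<not> bounded (connected_component_set (- darkened_drawing \<delta>) (x, y))"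
proof (rule unbounded_component_ray[of "(1, 0)"])
  fix t :: real assume "0 \<le> t"
  \<comment> \<open>For positive t the point is strictly to the right of the exterior point; t = 0
    is the hypothesis on the start.\<close>
  have "(x + t, y) \<notin> darkened_drawing \<delta>"
    using darkened_drawing_quadrant[of "x + t" y \<delta>] p assms(2) \<open>0 \<le> t\<close> by (cases "t = 0") auto
  then show "(x, y) + t *\<^sub>R (1, 0) \<in> - darkened_drawing \<delta>" by simp
qed (simp add: zero_prod_def)

lemma unbounded_below:
  fixes \<delta> :: "('m :: {finite,linorder}, 'n :: {finite,linorder}) labeling"
  assumes p: "(x, y) \<notin> darkened_drawing \<delta>" and "y + real CARD('m) + 2 \<le> 0"
  shows "\<not> bounded (connected_component_set (- darkened_drawing \<delta>) (x, y))"
proof (rule unbounded_component_ray[of "(0, -1)"])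
  fix t :: real assume "0 \<le> t"
  have "(x, y - t) \<notin> darkened_drawing \<delta>"
    using darkened_drawing_quadrant[of x "y - t" \<delta>] p assms(2) \<open>0 \<le> t\<close> by (cases "t = 0") auto
  then show "(x, y) + t *\<^sub>R (0, -1) \<in> - darkened_drawing \<delta>" by simp
qed (simp add: zero_prod_def)

lemma reach_cell_center_inner:
  fixes \<delta> :: "('m :: {finite,linorder}, 'n :: {finite,linorder}) labeling"
  assumes p: "(x, y) \<notin> darkened_drawing \<delta>"
    and "1 \<le> real CARD('n) + 2 - x" "1 \<le> y + real CARD('m) + 2"
    and bdd: "bounded (connected_component_set (- darkened_drawing \<delta>) (x, y))"
  shows "\<exists>k \<le> CARD('m). \<exists>l \<le> CARD('n). connected_component (- darkened_drawing \<delta>) (x, y) (cell_center k l)"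
proof -
  have xy: "1 \<le> - y" "1 \<le> x"
    by (rule leI, use unbounded_above[of y \<delta> x] bdd in blast)
       (rule leI, use unbounded_left[of x \<delta> y] bdd in blast)
  \<comment> \<open>The minimum covers z = N + 1, the far side of the last square.\<close>
  have cell: "\<exists>k \<le> N. real k \<le> z \<and> z \<le> real k + 1" if "1 \<le> z" "z \<le> real N + 1" for z N
  proof (intro exI conjI)
    show "min N (nat \<lfloor>z\<rfloor>) \<le> N" by simp
    have z: "real (nat \<lfloor>z\<rfloor>) \<le> z" "z \<le> real (nat \<lfloor>z\<rfloor>) + 1" using that by linarith+
    show "real (min N (nat \<lfloor>z\<rfloor>)) \<le> z" using z(1) by (auto simp: min_def)
    show "z \<le> real (min N (nat \<lfloor>z\<rfloor>)) + 1" using z(2) that by (auto simp: min_def)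
  qed
  obtain k where "k \<le> CARD('m)" "real k \<le> - y" "- y \<le> real k + 1"
    using cell[of "- y" "CARD('m)"] xy assms(3) by auto
  moreover obtain l where "l \<le> CARD('n)" "real l \<le> x" "x \<le> real l + 1"
    using cell[of x "CARD('n)"] xy assms(2) by auto
  ultimately show ?thesis using connected_component_cell_center[OF p] by blast
qed

text \<open>Dividing by the smaller distance c makes that distance 1, so the path leaves the wedge
  where it joins the grid squares.\<close>

lemma radial_path:
  fixes \<delta> :: "('m :: {finite,linorder}, 'n :: {finite,linorder}) labeling"
  defines "pt \<equiv> \<lambda>a b. (real CARD('n) + 2 - a, b - real CARD('m) - 2)"
  assumes p: "pt a b \<notin> darkened_drawing \<delta>" and ab: "0 < a" "0 < b" and c: "c = min a b" "c < 1"
  shows "connected_component (- darkened_drawing \<delta>) (pt a b) (pt (a / c) (b / c))"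
  unfolding connected_component_def
proof (intro exI conjI)
  let ?R = "(\<lambda>t. pt (t * a) (t * b)) ` {1..1 / c}"
  have "0 < c" using ab c by simp
  show "connected ?R" unfolding pt_def by (intro connected_continuous_image continuous_intros) auto
  show "pt a b \<in> ?R" by (rule image_eqI[of _ _ 1]) (use \<open>0 < c\<close> c in simp_all)
  show "pt (a / c) (b / c) \<in> ?R" by (rule image_eqI[of _ _ "1 / c"]) (use \<open>0 < c\<close> c in simp_all)
  show "?R \<subseteq> - darkened_drawing \<delta>"
  proof (intro image_subsetI ComplI)
    fix t assume "t \<in> {1..1 / c}" and dark: "pt (t * a) (t * b) \<in> darkened_drawing \<delta>"
    then have t: "1 \<le> t" "t * c \<le> 1" using \<open>0 < c\<close> by (simp_all add: field_simps)
    \<comment> \<open>A darkened arc met on the way already contains the starting point.\<close>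
    have "pt a b \<in> darkened_drawing \<delta>"
    proof (cases "b \<le> a")
      case True
      then have "t * b \<le> 1" using t c by simp
      note radial = on_vertical_radial[OF ab(2) True t(1) this, of _ "CARD('m)" _ "CARD('n)"]
      have "\<not> on_vertical CARD('n) CARD('m) (idx (j :: 'n)) (idx (i :: 'm)) (- (t * b - CARD('m) - 2)) (- (real CARD('n) + 2 - t * a))" for i j
        by (rule radial(2)[OF idx_le_CARD idx_le_CARD])
      moreover have "on_vertical CARD('m) CARD('n) (idx (i :: 'm)) (idx (j :: 'n)) (real CARD('n) + 2 - t * a) (t * b - CARD('m) - 2) \<Longrightarrow>
          on_vertical CARD('m) CARD('n) (idx i) (idx j) (real CARD('n) + 2 - a) (b - CARD('m) - 2)" for i j
        by (rule radial(1)[OF idx_le_CARD idx_le_CARD])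
      ultimately show ?thesis using dark unfolding pt_def darkened_drawing_iff by blast
    next
      case False
      then have *: "a \<le> b" "t * a \<le> 1" using t c by simp_all
      note radial = on_vertical_radial[OF ab(1) * (1) t(1) *(2), of _ "CARD('n)" _ "CARD('m)"]
      have swap: "- (t * a - real CARD('n) - 2) = real CARD('n) + 2 - t * a"
        "- (real CARD('m) + 2 - t * b) = t * b - real CARD('m) - 2"
        "- (real CARD('n) + 2 - t * a) = t * a - real CARD('n) - 2"
        "- (t * b - real CARD('m) - 2) = real CARD('m) + 2 - t * b"
        "- (real CARD('n) + 2 - a) = a - real CARD('n) - 2"
        "- (b - real CARD('m) - 2) = real CARD('m) + 2 - b" by simp_all
      have "\<not> on_vertical CARD('m) CARD('n) (idx (i :: 'm)) (idx (j :: 'n)) (- (t * a - real CARD('n) - 2)) (- (real CARD('m) + 2 - t * b))" for i j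
        by (rule radial(2)[OF idx_le_CARD idx_le_CARD])
      moreover have "on_vertical CARD('n) CARD('m) (idx (j :: 'n)) (idx (i :: 'm)) (real CARD('m) + 2 - t * b) (t * a - CARD('n) - 2) \<Longrightarrow>
          on_vertical CARD('n) CARD('m) (idx j) (idx i) (real CARD('m) + 2 - b) (a - CARD('n) - 2)" for i j
        by (rule radial(1)[OF idx_le_CARD idx_le_CARD])
      ultimately show ?thesis using dark unfolding pt_def darkened_drawing_iff swap by blast
    qed
    with p show False ..
  qed
qed

text \<open>Points right of or below the open quadrant of the exterior point have unbounded
  components; points in the wedges first move radially to the grid. Hence bounded faces are detected
  by finitely many centres.\<close>

lemma reach_cell_center:
  fixes \<delta> :: "('m :: {finite,linorder}, 'n :: {finite,linorder}) labeling"
  assumes C: "C \<in> bounded_faces (darkened_drawing \<delta>)"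
  obtains k l where "k \<le> CARD('m)" "l \<le> CARD('n)" "cell_center k l \<in> C"
proof -
  obtain x y where p: "(x, y) \<notin> darkened_drawing \<delta>" and C': "C = connected_component_set (- darkened_drawing \<delta>) (x, y)"
    using C unfolding bounded_faces_def components_def by fastforce
  have bdd: "bounded (connected_component_set (- darkened_drawing \<delta>) (x, y))"
    using C by (simp add: bounded_faces_def C')
  define a b where "a = real CARD('n) + 2 - x" and "b = y + real CARD('m) + 2"
  have xy: "(x, y) = (real CARD('n) + 2 - a, b - real CARD('m) - 2)" by (simp add: a_def b_def)
  have ab: "0 < a" "0 < b"
    using unbounded_right[OF p] unbounded_below[OF p] bdd unfolding a_def b_def by linarith+
  have "\<exists>k \<le> CARD('m). \<exists>l \<le> CARD('n). connected_component (- darkened_drawing \<delta>) (x, y) (cell_center k l)"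
  proof (cases "min a b < 1")
    case False
    then show ?thesis using reach_cell_center_inner[OF p _ _ bdd] by (simp add: a_def b_def)
  next
    case True
    define c where "c = min a b"
    define x' y' where "x' = real CARD('n) + 2 - a / c" and "y' = b / c - real CARD('m) - 2"
    have path: "connected_component (- darkened_drawing \<delta>) (x, y) (x', y')"
      using radial_path[OF p[unfolded xy] ab c_def] True unfolding xy x'_def y'_def by (simp add: c_def)
    then have "(x', y') \<notin> darkened_drawing \<delta>" using connected_component_in by blast
    moreover have "connected_component_set (- darkened_drawing \<delta>) (x', y') = connected_component_set (- darkened_drawing \<delta>) (x, y)"
      using path connected_component_eq by fastforce
    moreover have "1 \<le> a / c" "1 \<le> b / c" using ab by (simp_all add: c_def)
    ultimately have "\<exists>k \<le> CARD('m). \<exists>l \<le> CARD('n). connected_component (- darkened_drawing \<delta>) (x', y') (cell_center k l)"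
      using bdd by (intro reach_cell_center_inner) (simp_all add: x'_def y'_def)
    then show ?thesis using path connected_component_trans by blast
  qed
  then show thesis using that C' by auto
qed

text \<open>The midpoint of the edge is off the drawing and lies in both closed squares.\<close>

lemma vertical_edge_connects_cells:
  fixes \<delta> :: "('m :: {finite,linorder}, 'n :: {finite,linorder}) labeling"
  assumes "vlab \<delta> i j \<noteq> {0, 1}"
  shows "connected_component (- darkened_drawing \<delta>) (cell_center (idx i) (idx j)) (cell_center (idx i) (idx j - 1))"
proof -
  let ?p = "(real (idx j), - (real (idx i) + 1 / 2))"
  have "?p \<notin> darkened_drawing \<delta>"
  proof
    assume "?p \<in> darkened_drawing \<delta>"
    then consider i' j' where "vlab \<delta> i' j' = {0, 1}" "on_vertical CARD('m) CARD('n) (idx i') (idx j') (real (idx j)) (- (real (idx i) + 1 / 2))"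
      | i' j' where "on_vertical CARD('n) CARD('m) (idx (j' :: 'n)) (idx (i' :: 'm)) (real (idx i) + 1 / 2) (- real (idx j))"
      unfolding darkened_drawing_iff minus_minus by blast
    then show False
    proof cases
      case 1
      then have "i' = i" "j' = j" using on_vertical_midpoint[OF 1(2) idx_le_CARD] by (simp_all add: idx_eq_iff)
      with 1(1) assms show False by simp
    next
      case 2
      then show False using on_vertical_midpoint_swap[OF idx_le_CARD] by blast
    qed
  qed
  note center = connected_component_cell_center[OF this idx_le_CARD[of i]]
  have "connected_component (- darkened_drawing \<delta>) ?p (cell_center (idx i) (idx j))"
    by (rule center[OF idx_le_CARD]) simp_all
  moreover have "connected_component (- darkened_drawing \<delta>) ?p (cell_center (idx i) (idx j - 1))"
    by (rule center) (use idx_le_CARD[of j] idx_ge_1[of j] in \<open>simp_all add: of_nat_diff\<close>)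
  ultimately show ?thesis by (metis connected_component_sym connected_component_trans)
qed

lemma horizontal_edge_connects_cells:
  fixes \<delta> :: "('m :: {finite,linorder}, 'n :: {finite,linorder}) labeling"
  assumes "hlab \<delta> i j \<noteq> Star"
  shows "connected_component (- darkened_drawing \<delta>) (cell_center (idx i) (idx j)) (cell_center (idx i - 1) (idx j))"
proof -
  let ?p = "(real (idx j) + 1 / 2, - real (idx i))"
  have "?p \<notin> darkened_drawing \<delta>"
  proof
    assume "?p \<in> darkened_drawing \<delta>"
    then consider i' j' where "hlab \<delta> i' j' = Star" "on_vertical CARD('n) CARD('m) (idx j') (idx i') (real (idx i)) (- (real (idx j) + 1 / 2))"
      | i' j' where "on_vertical CARD('m) CARD('n) (idx (i' :: 'm)) (idx (j' :: 'n)) (real (idx j) + 1 / 2) (- real (idx i))"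
      unfolding darkened_drawing_iff minus_minus by blast
    then show False
    proof cases
      case 1
      then have "i' = i" "j' = j" using on_vertical_midpoint[OF 1(2) idx_le_CARD] by (simp_all add: idx_eq_iff)
      with 1(1) assms show False by simp
    next
      case 2
      then show False using on_vertical_midpoint_swap[OF idx_le_CARD] by blast
    qed
  qed
  note center = connected_component_cell_center[OF this _ idx_le_CARD[of j]]
  have "connected_component (- darkened_drawing \<delta>) ?p (cell_center (idx i) (idx j))"
    by (rule center[OF idx_le_CARD]) simp_all
  moreover have "connected_component (- darkened_drawing \<delta>) ?p (cell_center (idx i - 1) (idx j))"
    by (rule center) (use idx_le_CARD[of i] idx_ge_1[of i] in \<open>simp_all add: of_nat_diff\<close>)
  ultimately show ?thesis by (metis connected_component_sym connected_component_trans)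
qed

lemma cell_value_cell_center:
  fixes D :: "real ^ 'n :: {finite,linorder} ^ 'm :: {finite,linorder}"
  assumes "k \<le> CARD('m)" "l \<le> CARD('n)"
  shows "cell_value D (cell_center k l) = corner_sum D k l"
proof -
  have center: "nat \<lfloor>col_coord m n (real j + 1 / 2) (- (real i + 1 / 2))\<rfloor> = j" if "i \<le> m" for m n i j
  proof -
    have "min 1 (- (real i + 1 / 2) + real m + 2) = 1" using that by (simp add: min_def)
    then have "col_coord m n (real j + 1 / 2) (- (real i + 1 / 2)) = real j + 1 / 2"
      by (simp add: col_coord_def)
    then have "\<lfloor>col_coord m n (real j + 1 / 2) (- (real i + 1 / 2))\<rfloor> = int j" by linarith
    then show ?thesis by simp
  qed
  have "nat \<lfloor>col_coord CARD('n) CARD('m) (- snd (cell_center k l)) (- fst (cell_center k l))\<rfloor> = k"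
    "nat \<lfloor>col_coord CARD('m) CARD('n) (fst (cell_center k l)) (snd (cell_center k l))\<rfloor> = l"
    using center[OF assms(2), of "CARD('m)" k] center[OF assms(1), of "CARD('n)" l]
    by (simp_all only: cell_center_def fst_conv snd_conv minus_minus)
  moreover have "0 < real CARD('n) + 2 - fst (cell_center k l)" "0 < snd (cell_center k l) + real CARD('m) + 2"
    using assms by (simp_all add: cell_center_def)
  ultimately show ?thesis by (simp only: cell_value_def) simp
qed

lemma cell_center_notin_drawing:
  fixes \<delta> :: "('m :: {finite,linorder}, 'n :: {finite,linorder}) labeling"
  assumes "k \<le> CARD('m)" "l \<le> CARD('n)"
  shows "cell_center k l \<notin> darkened_drawing \<delta>"
  unfolding cell_center_def
  by (intro not_in_darkened_drawingI conjI on_vertical_not_in_open_cell[of k _ l] on_vertical_not_in_open_cell[of l _ k])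
     (use assms in simp_all)

text \<open>Hence the indicator of a bounded face vanishes on row and column 0, as
  \<open>corner_sum_corner_matrix\<close> requires.\<close>

lemma cell_center_notin_bounded_face:
  assumes "C \<in> bounded_faces (darkened_drawing \<delta>)"
  shows "cell_center 0 l \<notin> C" "cell_center k 0 \<notin> C"
proof -
  have "\<not> bounded C" if "p \<in> C" "\<not> bounded (connected_component_set (- darkened_drawing \<delta>) p)" for p
  proof -
    have "C \<in> components (- darkened_drawing \<delta>)" using assms by (simp add: bounded_faces_def)
    then obtain q where "C = connected_component_set (- darkened_drawing \<delta>) q"
      unfolding components_def by blast
    then have "C = connected_component_set (- darkened_drawing \<delta>) p"
      using that(1) connected_component_eq by metis
    with that(2) show ?thesis by simp
  qed
  moreover have "bounded C" using assms by (simp add: bounded_faces_def)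
  ultimately have *: "p \<notin> C" if "\<not> bounded (connected_component_set (- darkened_drawing \<delta>) p)" for p
    using that by blast
  show "cell_center 0 l \<notin> C" "cell_center k 0 \<notin> C"
    unfolding cell_center_def by (intro * unbounded_above, simp) (intro * unbounded_left, simp)
qed

section \<open>Indicators of the bounded faces as a basis\<close>

definition face_indicator ::
    "(real \<times> real) set \<Rightarrow> real ^ 'n :: {finite,linorder} ^ 'm :: {finite,linorder}" where
  "face_indicator C = corner_matrix (\<lambda>k l. if cell_center k l \<in> C then 1 else 0)"

lemma corner_sum_face_indicator:
  fixes \<delta> :: "('m :: {finite,linorder}, 'n :: {finite,linorder}) labeling"
  assumes "C \<in> bounded_faces (darkened_drawing \<delta>)" "k \<le> CARD('m)" "l \<le> CARD('n)"
  shows "corner_sum (face_indicator C :: real ^ 'n :: {finite,linorder} ^ 'm :: {finite,linorder}) k l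
     = (if cell_center k l \<in> C then 1 else 0)"
  unfolding face_indicator_def
  by (rule corner_sum_corner_matrix) (use assms cell_center_notin_bounded_face[OF assms(1)] in auto)

text \<open>Cells on the two sides of an undarkened edge lie in the same component, so the indicator
  has no jump there.\<close>

lemma face_indicator_in_labeling_space:
  fixes \<delta> :: "('m :: {finite,linorder}, 'n :: {finite,linorder}) labeling"
  assumes C: "C \<in> bounded_faces (darkened_drawing \<delta>)"
  shows "face_indicator C \<in> labeling_space \<delta>"
proof -
  have same: "p \<in> C \<longleftrightarrow> q \<in> C" if "connected_component (- darkened_drawing \<delta>) p q" for p q
    using C that unfolding bounded_faces_def components_def
    by (auto intro: connected_component_trans connected_component_sym)
  have "col_sum (face_indicator C) i j = 0" if "vlab \<delta> i j \<noteq> {0, 1}" for i j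
    using same[OF vertical_edge_connects_cells[OF that]] idx_le_CARD[of i] idx_le_CARD[of j]
    by (simp add: col_sum_corner corner_sum_face_indicator[OF C])
  moreover have "row_sum (face_indicator C) i j = 0" if "hlab \<delta> i j \<noteq> Star" for i j
    using same[OF horizontal_edge_connects_cells[OF that]] idx_le_CARD[of i] idx_le_CARD[of j]
    by (simp add: row_sum_corner corner_sum_face_indicator[OF C])
  ultimately show ?thesis by (simp add: labeling_space_def)
qed

lemma bounded_faces_disjoint:
  assumes "C \<in> bounded_faces X" "C' \<in> bounded_faces X" "p \<in> C" "p \<in> C'"
  shows "C = C'"
  using assms components_nonoverlap[of C "- X" C'] unfolding bounded_faces_def by blast

text \<open>Choosing a centre in each face is injective because distinct components are
  disjoint.\<close>

lemma finite_bounded_faces: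
  fixes \<delta> :: "('m :: {finite,linorder}, 'n :: {finite,linorder}) labeling"
  shows "finite (bounded_faces (darkened_drawing \<delta>))"
proof -
  let ?centers = "(\<lambda>(k, l). cell_center k l) ` ({..CARD('m)} \<times> {..CARD('n)})"
  have "\<exists>c. c \<in> C \<inter> ?centers" if C: "C \<in> bounded_faces (darkened_drawing \<delta>)" for C
  proof -
    obtain k l where "k \<le> CARD('m)" "l \<le> CARD('n)" "cell_center k l \<in> C"
      using reach_cell_center[OF C] by blast
    then have "cell_center k l \<in> C \<inter> ?centers" by (intro IntI image_eqI[of _ _ "(k, l)"]) simp_all
    then show ?thesis ..
  qed
  then obtain c where c: "c C \<in> C \<inter> ?centers" if "C \<in> bounded_faces (darkened_drawing \<delta>)" for C
    by metis
  have "inj_on c (bounded_faces (darkened_drawing \<delta>))"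
    by (intro inj_onI bounded_faces_disjoint) (use c in \<open>blast, blast, blast, metis IntD1\<close>)
  moreover have "c ` bounded_faces (darkened_drawing \<delta>) \<subseteq> ?centers" using c by blast
  ultimately show ?thesis by (rule inj_on_finite) simp
qed

lemma dim_labeling_space:
  fixes \<delta> :: "('m :: {finite,linorder}, 'n :: {finite,linorder}) labeling"
  shows "dim (labeling_space \<delta>) = card (bounded_faces (darkened_drawing \<delta>))"
proof -
  let ?BF = "bounded_faces (darkened_drawing \<delta>)"
  let ?I = "face_indicator :: _ \<Rightarrow> ((real, 'n) vec, 'm) vec"
  \<comment> \<open>Evaluating corner sums at a centre inside C is a linear functional dual to the
    indicator of C.\<close>
  have separate: "\<exists>k l. corner_sum (?I C) k l = 1 \<and> (\<forall>C'\<in>?BF - {C}. corner_sum (?I C') k l = 0)"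
    if C: "C \<in> ?BF" for C
  proof -
    obtain k l where kl: "k \<le> CARD('m)" "l \<le> CARD('n)" "cell_center k l \<in> C"
      using reach_cell_center[OF C] by blast
    have "corner_sum (?I C) k l = 1" using corner_sum_face_indicator[OF C kl(1,2)] kl(3) by simp
    moreover have "corner_sum (?I C') k l = 0" if "C' \<in> ?BF - {C}" for C'
    proof -
      have "C' \<in> ?BF" using that by blast
      moreover have "cell_center k l \<notin> C'" using bounded_faces_disjoint[OF C _ kl(3)] that by blast
      ultimately show ?thesis using corner_sum_face_indicator[OF _ kl(1,2)] by simp
    qed
    ultimately show ?thesis by blast
  qed
  have inj: "inj_on ?I ?BF"
  proof (rule inj_onI, rule ccontr)
    fix C C' assume C: "C \<in> ?BF" "C' \<in> ?BF" "?I C = ?I C'" "C \<noteq> C'"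
    obtain k l where "corner_sum (?I C) k l = 1" "\<forall>C'\<in>?BF - {C}. corner_sum (?I C') k l = 0"
      using separate[OF C(1)] by blast
    moreover have "C' \<in> ?BF - {C}" using C by blast
    ultimately show False using C(3) by simp
  qed
  have "independent (?I ` ?BF)"
    unfolding dependent_def
  proof
    assume "\<exists>a\<in>?I ` ?BF. a \<in> span (?I ` ?BF - {a})"
    then obtain C where C: "C \<in> ?BF" "?I C \<in> span (?I ` ?BF - {?I C})" by blast
    obtain k l where kl: "corner_sum (?I C) k l = 1" "\<forall>C'\<in>?BF - {C}. corner_sum (?I C') k l = 0"
      using separate[OF C(1)] by blast
    have "corner_sum (?I C) k l = 0"
      by (rule linear_eq_0_on_span[OF linear_corner_sum _ C(2)]) (use kl(2) in blast)
    with kl(1) show False by simp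
  qed
  moreover have "?I ` ?BF \<subseteq> labeling_space \<delta>" using face_indicator_in_labeling_space by blast
  moreover have "labeling_space \<delta> \<subseteq> span (?I ` ?BF)"
  proof
    fix D assume D: "D \<in> labeling_space \<delta>"
    \<comment> \<open>The coefficient of a face is the constant value of the extension on
      it.\<close>
    define g where "g C = cell_value D (SOME p. p \<in> C)" for C
    have const: "cell_value D p = g C" if "C \<in> ?BF" "p \<in> C" for C p
    proof -
      have "connected C" "C \<subseteq> - darkened_drawing \<delta>"
        using that(1) in_components_connected in_components_subset unfolding bounded_faces_def by blast+
      moreover have "(SOME p. p \<in> C) \<in> C" using that(2) by (rule someI)
      ultimately show ?thesis unfolding g_def using cell_value_constant[OF D] that(2) by blast
    qed
    have "D = (\<Sum>C\<in>?BF. g C *\<^sub>R ?I C)"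
    proof (rule corner_sum_eqI)
      fix k l assume kl: "k \<le> CARD('m)" "l \<le> CARD('n)"
      let ?c = "cell_center k l"
      let ?C = "connected_component_set (- darkened_drawing \<delta>) ?c"
      have c: "?c \<in> ?C" using cell_center_notin_drawing[OF kl] by simp
      have C: "?C \<in> components (- darkened_drawing \<delta>)"
        using cell_center_notin_drawing[OF kl] by (intro componentsI) simp
      have "corner_sum (\<Sum>C\<in>?BF. g C *\<^sub>R ?I C) k l = (\<Sum>C\<in>?BF. g C * (if ?c \<in> C then 1 else 0))"
        by (simp add: linear_sum[OF linear_corner_sum] linear_cmul[OF linear_corner_sum]
            corner_sum_face_indicator[OF _ kl])
      also have "\<dots> = (\<Sum>C\<in>?BF. if C = ?C then g C else 0)"
      proof (rule sum.cong[OF refl])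
        fix C' assume C': "C' \<in> ?BF"
        have "?c \<in> C' \<longleftrightarrow> C' = ?C"
          using c C C' components_nonoverlap[of C' "- darkened_drawing \<delta>" ?C] unfolding bounded_faces_def by blast
        then show "g C' * (if ?c \<in> C' then 1 else 0) = (if C' = ?C then g C' else 0)" by simp
      qed
      also have "\<dots> = (if ?C \<in> ?BF then g ?C else 0)"
        by (simp add: sum.delta finite_bounded_faces)
      also have "\<dots> = cell_value D ?c"
      proof (cases "bounded ?C")
        case True
        then have "?C \<in> ?BF" using C by (simp add: bounded_faces_def)
        then show ?thesis using const c by simp
      next
        case False
        \<comment> \<open>An unbounded component contributes no term, so its value has to be 0; a
          far point shows this.\<close>
        have "\<exists>q\<in>?C. \<not> norm q \<le> 2 * (real CARD('m) + real CARD('n) + 2)"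
          using False unfolding bounded_iff by blast
        then obtain q where q: "q \<in> ?C" "\<not> norm q \<le> 2 * (real CARD('m) + real CARD('n) + 2)" ..
        have "cell_value D q = 0" using cell_value_nonzero_bounded[of D q] q(2) by blast
        moreover have "cell_value D ?c = cell_value D q"
          by (rule cell_value_constant[OF D _ _ c q(1)]) (use C in \<open>simp_all add: in_components_connected in_components_subset\<close>)
        ultimately show ?thesis using False by (simp add: bounded_faces_def)
      qed
      finally show "corner_sum D k l = corner_sum (\<Sum>C\<in>?BF. g C *\<^sub>R ?I C) k l"
        by (simp add: cell_value_cell_center[OF kl])
    qed
    also have "\<dots> \<in> span (?I ` ?BF)" by (intro span_sum span_scale span_base imageI)
    finally show "D \<in> span (?I ` ?BF)" .
  qed
  ultimately show ?thesis
    by (intro dim_unique[of "?I ` ?BF"]) (simp_all add: card_image inj)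
qed

section \<open>The isomorphism\<close>

theorem theorem7p16:
  shows "bij_betw face_labeling
           {F :: (real ^ 'n :: {finite,linorder} ^ 'm :: {finite,linorder}) set. F face_of sign_matrix_polytope}
           {\<delta> :: ('m :: {finite,linorder}, 'n :: {finite,linorder}) labeling. is_component \<delta>}
    \<and> (\<forall>F F' :: (real ^ 'n :: {finite,linorder} ^ 'm :: {finite,linorder}) set.
         F face_of sign_matrix_polytope \<longrightarrow> F' face_of sign_matrix_polytope \<longrightarrow>
           (F \<subseteq> F' \<longleftrightarrow> contained_in (face_labeling F) (face_labeling F')))
    \<and> (\<forall>F :: (real ^ 'n :: {finite,linorder} ^ 'm :: {finite,linorder}) set.
         F face_of sign_matrix_polytope \<longrightarrow> aff_dim F = num_regions (face_labeling F))"
  unfolding sign_matrix_polytope_eq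
proof (intro conjI allI impI)
  show "bij_betw face_labeling
           {F :: (real ^ 'n :: {finite,linorder} ^ 'm :: {finite,linorder}) set. F face_of flow_polytope}
           {\<delta> :: ('m :: {finite,linorder}, 'n :: {finite,linorder}) labeling. is_component \<delta>}"
  proof (rule bij_betw_byWitness[where f' = labeling_face])
    show "face_labeling ` {F :: ((real, 'n) vec, 'm) vec set. F face_of flow_polytope} \<subseteq> {\<delta>. is_component \<delta>}"
    proof (intro image_subsetI CollectI)
      fix F :: "((real, 'n) vec, 'm) vec set"
      assume "F \<in> {F. F face_of flow_polytope}"
      then have "face_labeling F = labeling_union (zero_dim_component ` {M. sign_matrix M \<and> M \<in> F})"
        by (intro face_labeling_eq) simp
      then show "is_component (face_labeling F)"
        unfolding is_component_iff by (intro exI conjI) auto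
    qed
  qed (simp_all add: face_eq_labeling_face face_labeling_labeling_face image_subset_iff labeling_face_face_of)
next
  fix F F' :: "((real, 'n) vec, 'm) vec set"
  assume F: "F face_of flow_polytope" and F': "F' face_of flow_polytope"
  show "F \<subseteq> F' \<longleftrightarrow> contained_in (face_labeling F) (face_labeling F')"
  proof
    assume "F \<subseteq> F'"
    then have "{M. sign_matrix M \<and> M \<in> F} \<subseteq> {M. sign_matrix M \<and> M \<in> F'}" by blast
    then show "contained_in (face_labeling F) (face_labeling F')"
      unfolding face_labeling_eq[OF F] face_labeling_eq[OF F'] by (rule labeling_union_mono)
  next
    assume "contained_in (face_labeling F) (face_labeling F')"
    \<comment> \<open>The inverse map is monotone as well, so containment of labelings gives
      inclusion of faces.\<close>
    from labeling_face_mono[OF this] show "F \<subseteq> F'"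
      unfolding face_eq_labeling_face[OF F] face_eq_labeling_face[OF F'] .
  qed
next
  fix F :: "((real, 'n) vec, 'm) vec set"
  assume F: "F face_of flow_polytope"
  show "aff_dim F = num_regions (face_labeling F)"
  proof (cases "F = {}")
    case True
    then have "face_labeling F = empty_labeling" using face_labeling_eq[OF F] by (simp add: labeling_union_empty)
    then show ?thesis using True by (simp add: num_regions_def)
  next
    case False
    have "face_labeling F \<noteq> empty_labeling"
    proof
      assume "face_labeling F = empty_labeling"
      then have "\<And>i j. vlab (face_labeling F) i j = {}" by (simp add: empty_labeling_def)
      then have "labeling_face (face_labeling F) = {}" by (auto simp: labeling_face_def)
      then show False using False face_eq_labeling_face[OF F] by simp
    qed
    then show ?thesis by (simp add: num_regions_def aff_dim_face[OF F False] dim_labeling_space)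
  qed
qed

end
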